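(* Let $\omega=\sqrt{4\rho-\gamma^2}$. Under the coordinate transformation $$y=\int^x\omega(t,\xi)\,d\xi,\quad \tau=t,\quad Q(\tau,y)=\frac1{\omega}\Big(1-\frac{\omega_x}{\omega}\Big),\quad P(\tau,y)=-\frac{\gamma}{\omega},$$ the Hamiltonian pair $$\mathcal K=\begin{pmatrix}\rho\partial_x+\partial_x\rho&\gamma\partial_x\\ \partial_x\gamma&2\partial_x\end{pmatrix},\qquad \mathcal J=\begin{pmatrix}0&\partial_x-\partial_x^2\\ \partial_x+\partial_x^2&0\end{pmatrix}$$ admitted by the dual dispersive water wave (dDWW) system $$\rho_t=\big((\rho+v)u\big)_x,\quad \rho=v-v_x,\qquad \gamma_t=(\gamma u+2v)_x,\quad\gamma=u+u_x,$$ is converted to the pair of Hamiltonian operators $$\overline{\mathcal K}=2\begin{pmatrix}\mathcal X\big(P\mathcal X+\mathcal O P\partial_y^{-1}\big)\mathcal O&\mathcal X\big(P\mathcal XP\partial_y+\mathcal O(1+P\partial_y^{-1}P\partial_y)\big)\\ \mathcal Y\mathcal X\mathcal O+(P_y\partial_y^{-1}+P)\mathcal OP\partial_y^{-1}\mathcal O&\mathcal Y\mathcal XP\partial_y+(P_y\partial_y^{-1}+P)\mathcal O(1+P\partial_y^{-1}P\partial_y)\end{pmatrix},$$ $$\overline{\mathcal J}=2\begin{pmatrix}\mathcal X\mathcal O&\mathcal XP\partial_y\\ \partial_yP\partial_y^{-1}\mathcal O&\partial_y(1+P\partial_y^{-1}P\partial_y)\end{pmatrix},$$ where $\mathcal O=Q\partial_y-\partial_y^2$,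 $\mathcal X=\partial_y+Q+Q_y\partial_y^{-1}$ and $\mathcal Y=1+P^2+P_y\partial_y^{-1}P$. Here $\mathcal J$ is converted to $\overline{\mathcal K}$ and $\mathcal K$ to $\overline{\mathcal J}$: $\overline{\mathcal K}=\omega^{-1}\mathbf T\mathcal J\mathbf T^*$ and $\overline{\mathcal J}=\omega^{-1}\mathbf T\mathcal K\mathbf T^*$.
   Context: All operators are formal matrix (pseudo-)differential operators with formal inverses $\partial_y^{-1}$; $\partial_x=\omega\partial_y$. "Converted" refers to the change-of-variables rule for Hamiltonian operators: for a transformation $y=I(x,\mathbf m)=\int^x\Lambda(\mathbf m)\,d\xi$, $\tau=t$, $Q_i=F_i(\mathbf m)$ ($i=1,\dots,N$), a Hamiltonian operator $\mathcal D(\mathbf m)$ becomes $\overline{\mathcal D}(\mathbf Q)=\Lambda^{-1}\mathbf T\,\mathcal D\,\mathbf T^*$, where $\mathbf T_{ij}=\Lambda\,\mathrm D_{F_i,m_j}-(D_xQ_i)\,\mathrm D_{I,m_j}$, $\mathrm D_{F_i,m_j}$ and $\mathrm D_{I,m_j}$ are Fréchet derivatives with respect to $m_j$, $D_x$ is the total $x$-derivative, and $\mathbf T^*$ is the formal $L^2(dx)$ adjoint. Here $\mathbf m=(\rho,\gamma)$, $\mathbf Q=(Q,P)$, $\Lambda=\omega$. *)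

theory Defs
  imports "HOL-Analysis.Analysis"
begin

section \<open>Differential algebras\<close>

class differential_algebra = real_algebra_1 + comm_ring_1 +
  fixes Dx :: "'a \<Rightarrow> 'a"
  assumes Dx_add: "Dx (f + g) = Dx f + Dx g"
    and Dx_scaleR: "Dx (c *\<^sub>R f) = c *\<^sub>R Dx f"
    and Dx_mult: "Dx (f * g) = Dx f * g + f * Dx g"

text \<open>
  Algebras of differential functions in the sense of Barakat, De Sole and Kac: functions of the
  dependent variables \<open>u i\<close> and of their \<open>x\<close>-derivatives, where \<open>pd i n\<close> is the partial derivative
  with respect to the \<open>n\<close>-th \<open>x\<close>-derivative of \<open>u i\<close> and \<open>Dx\<close> is the total \<open>x\<close>-derivative.
  Examples are the smooth functions of finitely many jet coordinates on an open subset of the jet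
  space, for instance on \<open>{4 \<rho> > \<gamma>\<^sup>2}\<close>. The time \<open>t\<close> is a parameter and does not appear.
\<close>

locale differential_functions =
  fixes u :: "'n::finite \<Rightarrow> 'a::differential_algebra"
    and pd :: "'n \<Rightarrow> nat \<Rightarrow> 'a \<Rightarrow> 'a"
  assumes pd_add: "pd i n (f + g) = pd i n f + pd i n g"
    and pd_scaleR: "pd i n (c *\<^sub>R f) = c *\<^sub>R pd i n f"
    and pd_mult: "pd i n (f * g) = pd i n f * g + f * pd i n g"
    and pd_commute: "pd i m (pd j n f) = pd j n (pd i m f)"
    and pd_jet: "pd i n ((Dx ^^ m) (u j)) = of_bool (i = j \<and> n = m)"
    and pd_finite: "finite {n. pd i n f \<noteq> 0}"
    and pd_Dx: "pd i n (Dx f) = Dx (pd i n f) + (if n = 0 then 0 else pd i (n - 1) f)"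


section \<open>Formal pseudo-differential operators\<close>

text \<open>
  The operator \<open>\<Sum>\<^sub>n a n \<partial>\<^sub>x\<^sup>n\<close>, with \<open>n\<close> ranging over the integers up to some bound, is represented
  by its coefficient family \<open>a\<close>.
\<close>

typedef (overloaded) 'a pdo = "{a :: int \<Rightarrow> 'a::zero. \<exists>N. \<forall>n>N. a n = 0}"
  morphisms pcoeff Abs_pdo
  by (rule exI[of _ "\<lambda>_. 0"]) simp

setup_lifting type_definition_pdo

lemma pdo_eqI: "(\<And>n. pcoeff p n = pcoeff q n) \<Longrightarrow> p = q"
  by transfer auto

lemma pcoeff_bound: "\<exists>N. \<forall>n>N. pcoeff p n = 0"
  by transfer auto

instantiation pdo :: (differential_algebra) "{zero, one, plus, minus, uminus, times}"
begin

lift_definition zero_pdo :: "'a pdo" is "\<lambda>_. 0"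
  by simp

lift_definition one_pdo :: "'a pdo" is "\<lambda>n. of_bool (n = 0)"
  by (auto intro!: exI[of _ 0])

lift_definition plus_pdo :: "'a pdo \<Rightarrow> 'a pdo \<Rightarrow> 'a pdo" is "\<lambda>p q n. p n + q n"
proof -
  fix p q :: "int \<Rightarrow> 'a"
  assume "\<exists>N. \<forall>n>N. p n = 0" "\<exists>N. \<forall>n>N. q n = 0"
  then obtain N M where "\<forall>n>N. p n = 0" "\<forall>n>M. q n = 0" by blast
  then show "\<exists>N. \<forall>n>N. p n + q n = 0" by (intro exI[of _ "max N M"]) auto
qed

lift_definition minus_pdo :: "'a pdo \<Rightarrow> 'a pdo \<Rightarrow> 'a pdo" is "\<lambda>p q n. p n - q n"
proof -
  fix p q :: "int \<Rightarrow> 'a"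
  assume "\<exists>N. \<forall>n>N. p n = 0" "\<exists>N. \<forall>n>N. q n = 0"
  then obtain N M where "\<forall>n>N. p n = 0" "\<forall>n>M. q n = 0" by blast
  then show "\<exists>N. \<forall>n>N. p n - q n = 0" by (intro exI[of _ "max N M"]) auto
qed

lift_definition uminus_pdo :: "'a pdo \<Rightarrow> 'a pdo" is "\<lambda>p n. - p n"
  by auto

text \<open>
  Composition of operators, from the Leibniz rule
  \<open>\<partial>\<^sub>x\<^sup>i \<circ> f = \<Sum>\<^sub>k (i choose k) (Dx\<^sup>k f) \<partial>\<^sub>x\<^bsup>i-k\<^esup>\<close>, valid for all integers \<open>i\<close>;
  the coefficient of \<open>\<partial>\<^sub>x\<^sup>n\<close> collects the terms with \<open>k = i + j - n\<close>. The index set is finite.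
\<close>

lift_definition times_pdo :: "'a pdo \<Rightarrow> 'a pdo \<Rightarrow> 'a pdo" is
  "\<lambda>(p :: int \<Rightarrow> 'a) (q :: int \<Rightarrow> 'a) (n :: int). \<Sum>(i, j) | p i \<noteq> 0 \<and> q j \<noteq> 0 \<and> n \<le> i + j.
     of_real (of_int i gchoose nat (i + j - n)) * p i * (Dx ^^ nat (i + j - n)) (q j)"
proof -
  fix p q :: "int \<Rightarrow> 'a"
  assume "\<exists>N. \<forall>n>N. p n = 0" "\<exists>N. \<forall>n>N. q n = 0"
  then obtain N M where NM: "\<forall>n>N. p n = 0" "\<forall>n>M. q n = 0" by blast
  have "{(i, j). p i \<noteq> 0 \<and> q j \<noteq> 0 \<and> n \<le> i + j} = {}" if "n > N + M" for n
  proof -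
    { fix i j assume "p i \<noteq> 0" "q j \<noteq> 0" "n \<le> i + j"
      with NM have "i \<le> N" "j \<le> M" by (meson not_le)+
      with \<open>n \<le> i + j\<close> that have False by simp }
    then show ?thesis by blast
  qed
  then show "\<exists>N. \<forall>n>N. (\<Sum>(i, j) | p i \<noteq> 0 \<and> q j \<noteq> 0 \<and> n \<le> i + j.
     of_real (of_int i gchoose nat (i + j - n)) * p i * (Dx ^^ nat (i + j - n)) (q j)) = 0"
    by (intro exI[of _ "N + M"] allI impI) (simp only: sum.empty)
qed

instance ..

end

subsection \<open>The operators form a ring\<close>

lemma Dx_zero [simp]: "Dx (0 :: 'a::differential_algebra) = 0"
  using Dx_scaleR[of 0 "0::'a"] by simp

lemma Dx_one [simp]: "Dx (1 :: 'a::differential_algebra) = 0"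
  using Dx_mult[of 1 "1::'a"] by simp

lemma Dx_sum: "Dx (\<Sum>x\<in>A. f x :: 'a::differential_algebra) = (\<Sum>x\<in>A. Dx (f x))"
  by (induction A rule: infinite_finite_induct) (auto simp: Dx_add)

lemma Dx_of_real: "Dx (of_real c :: 'a::differential_algebra) = 0"
  by (simp add: of_real_def Dx_scaleR)

lemma Dxn_zero [simp]: "(Dx ^^ n) (0 :: 'a::differential_algebra) = 0"
  by (induction n) auto

lemma Dxn_one: "(Dx ^^ n) (1 :: 'a::differential_algebra) = of_bool (n = 0)"
  by (induction n) (auto simp del: funpow.simps simp add: funpow_Suc_right)

lemma Dxn_add: "(Dx ^^ n) (f + g :: 'a::differential_algebra) = (Dx ^^ n) f + (Dx ^^ n) g"
  by (induction n) (auto simp: Dx_add)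

lemma Dxn_sum: "(Dx ^^ n) (\<Sum>x\<in>A. f x :: 'a::differential_algebra) = (\<Sum>x\<in>A. (Dx ^^ n) (f x))"
  by (induction n) (auto simp: Dx_sum)

lemma Dxn_of_real_mult:
  "(Dx ^^ n) (of_real c * f :: 'a::differential_algebra) = of_real c * (Dx ^^ n) f"
  by (induction n) (auto simp: Dx_mult Dx_of_real)

lemma Dxn_Dxn: "(Dx ^^ m) ((Dx ^^ n) f) = (Dx ^^ (m + n)) f"
  by (simp add: funpow_add)

lemma Dxn_mult:
  fixes f g :: "'a::differential_algebra"
  shows "(Dx ^^ n) (f * g) = (\<Sum>c\<le>n. of_nat (n choose c) * (Dx ^^ c) f * (Dx ^^ (n - c)) g)"
proof (induction n)
  case (Suc n)
  let ?F = "\<lambda>c d. (Dx ^^ c) f * (Dx ^^ d) g"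
  have D: "Dx (of_nat k * h) = of_nat k * Dx h" for k and h :: 'a
    using Dxn_of_real_mult[of 1 "real k" h] by simp
  have "(Dx ^^ Suc n) (f * g) = (\<Sum>c\<le>n. of_nat (n choose c) * Dx (?F c (n - c)))"
    by (simp add: Suc Dx_sum D mult.assoc)
  also have "\<dots> = (\<Sum>c\<le>n. of_nat (n choose c) * ?F (Suc c) (n - c))
      + (\<Sum>c\<le>n. of_nat (n choose c) * ?F c (Suc n - c))"
    by (simp add: Dx_mult algebra_simps sum.distrib Suc_diff_le)
  also have "(\<Sum>c\<le>n. of_nat (n choose c) * ?F c (Suc n - c))
      = (\<Sum>c\<le>Suc n. of_nat (n choose c) * ?F c (Suc n - c))"
    by (simp add: binomial_eq_0)
  also have "\<dots> = ?F 0 (Suc n) + (\<Sum>c\<le>n. of_nat (n choose Suc c) * ?F (Suc c) (n - c))"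
    by (subst sum.atMost_Suc_shift) simp
  also have "(\<Sum>c\<le>n. of_nat (n choose c) * ?F (Suc c) (n - c)) + \<dots>
     = ?F 0 (Suc n) + (\<Sum>c\<le>n. of_nat (Suc n choose Suc c) * ?F (Suc c) (n - c))"
    by (simp add: algebra_simps sum.distrib)
  also have "\<dots> = (\<Sum>c\<le>Suc n. of_nat (Suc n choose c) * ?F c (Suc n - c))"
    by (subst sum.atMost_Suc_shift) simp
  finally show ?case by (simp add: mult.assoc)
qed simp

lemma gbinomial_compose:
  fixes a b :: real
  assumes "c \<le> r"
  shows "(\<Sum>k=c..r. (a gchoose k) * of_nat (k choose c) * (b gchoose (r - k)))
    = (a gchoose c) * ((a + b - of_nat c) gchoose (r - c))"
proof -
  have "(\<Sum>k=c..r. (a gchoose k) * of_nat (k choose c) * (b gchoose (r - k)))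
     = (\<Sum>k=c..r. (a gchoose c) * (((a - of_nat c) gchoose (k - c)) * (b gchoose (r - k))))"
    by (intro sum.cong refl)
      (simp add: gbinomial_trinomial_revision binomial_gbinomial mult.assoc)
  also have "\<dots> = (a gchoose c) *
      (\<Sum>k=c..r. (((a - of_nat c) gchoose (k - c)) * (b gchoose (r - k))))"
    by (simp add: sum_distrib_left)
  also have "(\<Sum>k=c..r. (((a - of_nat c) gchoose (k - c)) * (b gchoose (r - k))))
     = (\<Sum>k=0..r - c. (((a - of_nat c) gchoose k) * (b gchoose (r - c - k))))"
    using assms
    by (intro sum.reindex_bij_witness[of _ "\<lambda>k. k + c" "\<lambda>k. k - c"]) auto
  also have "\<dots> = (a - of_nat c + b) gchoose (r - c)"
    by (rule gbinomial_Vandermonde)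
  also have "a - of_nat c + b = a + b - of_nat c"
    by simp
  finally show ?thesis .
qed

lemma pcoeff_zero [simp]: "pcoeff 0 n = 0"
  by transfer simp
lemma pcoeff_one: "pcoeff 1 n = of_bool (n = 0)"
  by transfer simp
lemma pcoeff_add [simp]: "pcoeff (p + q) n = pcoeff p n + pcoeff q n"
  by transfer simp
lemma pcoeff_diff [simp]: "pcoeff (p - q) n = pcoeff p n - pcoeff q n"
  by transfer simp
lemma pcoeff_uminus [simp]: "pcoeff (- p) n = - pcoeff p n"
  by transfer simp

definition triples :: "nat \<Rightarrow> (nat \<times> nat \<times> nat) set" where
  "triples s = {(m, l, k). m + l + k = s}"

lemma finite_triples [simp]: "finite (triples s)"
  by (rule finite_subset[of _ "{..s} \<times> {..s} \<times> {..s}"]) (auto simp: triples_def)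

lemma pcoeff_mult:
  fixes p q :: "'a::differential_algebra pdo"
  assumes A: "\<And>n. n > A \<Longrightarrow> pcoeff p n = 0" and B: "\<And>n. n > B \<Longrightarrow> pcoeff q n = 0"
  shows "pcoeff (p * q) (A + B - int s) = (\<Sum>(m, l, k)\<in>triples s.
    of_real (of_int (A - int m) gchoose k) * pcoeff p (A - int m) * (Dx ^^ k) (pcoeff q (B - int l)))"
proof -
  let ?n = "A + B - int s"
  let ?S = "{(i, j). pcoeff p i \<noteq> 0 \<and> pcoeff q j \<noteq> 0 \<and> ?n \<le> i + j}"
  let ?T = "{(m, l, k). (m, l, k) \<in> triples s \<and>
     pcoeff p (A - int m) \<noteq> 0 \<and> pcoeff q (B - int l) \<noteq> 0}"
  have le: "i \<le> A" "j \<le> B" if "pcoeff p i \<noteq> 0" "pcoeff q j \<noteq> 0" for i j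
    using A B that by (meson not_le)+
  have "pcoeff (p * q) ?n = (\<Sum>(i, j)\<in>?S. of_real (of_int i gchoose nat (i + j - ?n)) * pcoeff p i *
      (Dx ^^ nat (i + j - ?n)) (pcoeff q j))"
    by transfer simp
  also have "\<dots> = (\<Sum>(m, l, k)\<in>?T.
    of_real (of_int (A - int m) gchoose k) * pcoeff p (A - int m) * (Dx ^^ k) (pcoeff q (B - int l)))"
  proof (rule sum.reindex_bij_witness[of _
      "\<lambda>(m, l, k). (A - int m, B - int l)"
      "\<lambda>(i, j). (nat (A - i), nat (B - j), nat (i + j - ?n))"], goal_cases)
    case (1 a) then show ?case using le by (auto simp: triples_def)
  next
    case (2 a)
    then show ?case using le by (auto simp: triples_def) (smt (verit) le(1,2) nat_add_distrib nat_int)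
  next
    case (3 b) then show ?case by (auto simp: triples_def)
  next
    case (4 b) then show ?case by (auto simp: triples_def)
  next
    case (5 a) then show ?case using le by (auto simp: triples_def)
  qed
  also have "\<dots> = (\<Sum>(m, l, k)\<in>triples s.
    of_real (of_int (A - int m) gchoose k) * pcoeff p (A - int m) * (Dx ^^ k) (pcoeff q (B - int l)))"
    by (rule sum.mono_neutral_left) auto
  finally show ?thesis .
qed

lemma pcoeff_mult_bound:
  fixes p q :: "'a::differential_algebra pdo"
  assumes A: "\<And>n. n > A \<Longrightarrow> pcoeff p n = 0" and B: "\<And>n. n > B \<Longrightarrow> pcoeff q n = 0"
    and n: "n > A + B"
  shows "pcoeff (p * q) n = 0"
proof -
  have le: "i \<le> A" "j \<le> B" if "pcoeff p i \<noteq> 0" "pcoeff q j \<noteq> 0" for i j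
    using A B that by (meson not_le)+
  have e: "{(i, j). pcoeff p i \<noteq> 0 \<and> pcoeff q j \<noteq> 0 \<and> n \<le> i + j} = {}"
    using le n by fastforce
  have "pcoeff (p * q) n = (\<Sum>(i, j)\<in>{(i, j). pcoeff p i \<noteq> 0 \<and> pcoeff q j \<noteq> 0 \<and> n \<le> i + j}.
      of_real (of_int i gchoose nat (i + j - n)) * pcoeff p i *
      (Dx ^^ nat (i + j - n)) (pcoeff q j))"
    by transfer simp
  then show ?thesis unfolding e by simp
qed

lemma sum_triples_assoc_left:
  fixes f :: "nat \<Rightarrow> nat \<Rightarrow> nat \<Rightarrow> nat \<Rightarrow> nat \<Rightarrow> 'b::comm_monoid_add"
  shows "(\<Sum>(t, l', k')\<in>triples s. \<Sum>(m, l, k)\<in>triples t. f m l l' k k')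
    = (\<Sum>(m, t, r)\<in>triples s. \<Sum>(l, l')\<in>{(l, l'). l + l' = t}. \<Sum>k\<le>r. f m l l' k (r - k))"
proof -
  have fin: "finite {p. fst p + snd p = (t::nat)}" for t
    by (rule finite_subset[of _ "{..t} \<times> {..t}"]) auto
  have "(\<Sum>(t, l', k')\<in>triples s. \<Sum>(m, l, k)\<in>triples t. f m l l' k k')
     = (\<Sum>((t, l', k'), (m, l, k))\<in>(SIGMA x:triples s. triples (fst x)). f m l l' k k')"
    by (simp add: sum.Sigma case_prod_unfold)
  also have "\<dots> = (\<Sum>((m, t, r), (l, l'), k)\<in>(SIGMA x:triples s.
      {(l, l'). l + l' = fst (snd x)} \<times> {..snd (snd x)}). f m l l' k (r - k))"
    by (rule sum.reindex_bij_witness[of _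
      "\<lambda>((m, t, r), (l, l'), k). ((m + l + k, l', r - k), (m, l, k))"
      "\<lambda>((t, l', k'), (m, l, k)). ((m, l + l', k + k'), (l, l'), k)"])
      (auto simp: triples_def)
  also have "\<dots> = (\<Sum>x\<in>triples s. \<Sum>y\<in>{(l, l'). l + l' = fst (snd x)} \<times> {..snd (snd x)}.
      f (fst x) (fst (fst y)) (snd (fst y)) (snd y) (snd (snd x) - snd y))"
    by (subst sum.Sigma) (auto simp: fin case_prod_unfold)
  also have "\<dots> = (\<Sum>(m, t, r)\<in>triples s. \<Sum>(l, l')\<in>{(l, l'). l + l' = t}. \<Sum>k\<le>r. f m l l' k (r - k))"
    by (simp add: sum.cartesian_product case_prod_unfold)
  finally show ?thesis .
qed

lemma sum_triples_assoc_right: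
  fixes f :: "nat \<Rightarrow> nat \<Rightarrow> nat \<Rightarrow> nat \<Rightarrow> nat \<Rightarrow> 'b::comm_monoid_add"
  shows "(\<Sum>(m, t, k)\<in>triples s. \<Sum>(l, l', k')\<in>triples t. f m l l' k k')
    = (\<Sum>(m, t, r)\<in>triples s. \<Sum>(l, l')\<in>{(l, l'). l + l' = t}. \<Sum>k\<le>r. f m l l' k (r - k))"
proof -
  have fin: "finite {p. fst p + snd p = (t::nat)}" for t
    by (rule finite_subset[of _ "{..t} \<times> {..t}"]) auto
  have "(\<Sum>(m, t, k)\<in>triples s. \<Sum>(l, l', k')\<in>triples t. f m l l' k k')
     = (\<Sum>((m, t, k), (l, l', k'))\<in>(SIGMA x:triples s. triples (fst (snd x))). f m l l' k k')"
    by (simp add: sum.Sigma case_prod_unfold)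
  also have "\<dots> = (\<Sum>((m, t, r), (l, l'), k)\<in>(SIGMA x:triples s.
      {(l, l'). l + l' = fst (snd x)} \<times> {..snd (snd x)}). f m l l' k (r - k))"
    by (rule sum.reindex_bij_witness[of _
      "\<lambda>((m, t, r), (l, l'), k). ((m, t + (r - k), k), (l, l', r - k))"
      "\<lambda>((m, t, k), (l, l', k')). ((m, l + l', k + k'), (l, l'), k)"])
      (auto simp: triples_def)
  also have "\<dots> = (\<Sum>x\<in>triples s. \<Sum>y\<in>{(l, l'). l + l' = fst (snd x)} \<times> {..snd (snd x)}.
      f (fst x) (fst (fst y)) (snd (fst y)) (snd y) (snd (snd x) - snd y))"
    by (subst sum.Sigma) (auto simp: fin case_prod_unfold)
  also have "\<dots> = (\<Sum>(m, t, r)\<in>triples s. \<Sum>(l, l')\<in>{(l, l'). l + l' = t}. \<Sum>k\<le>r. f m l l' k (r - k))"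
    by (simp add: sum.cartesian_product case_prod_unfold)
  finally show ?thesis .
qed

lemma Leibniz_compose:
  fixes b c :: "'a::differential_algebra"
  shows "(\<Sum>k\<le>r. of_real ((\<alpha> + \<beta> - of_nat k) gchoose (r - k)) * of_real (\<alpha> gchoose k) *
      (Dx ^^ k) b * (Dx ^^ (r - k)) c)
    = (\<Sum>k\<le>r. of_real (\<alpha> gchoose k) * of_real (\<beta> gchoose (r - k)) *
      (Dx ^^ k) (b * (Dx ^^ (r - k)) c))"
proof -
  let ?F = "\<lambda>d. (Dx ^^ d) b * (Dx ^^ (r - d)) c"
  have "(\<Sum>k\<le>r. of_real (\<alpha> gchoose k) * of_real (\<beta> gchoose (r - k)) *
      (Dx ^^ k) (b * (Dx ^^ (r - k)) c))
    = (\<Sum>k\<le>r. \<Sum>d\<le>k. of_real ((\<alpha> gchoose k) * of_nat (k choose d) * (\<beta> gchoose (r - k))) * ?F d)"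
    by (intro sum.cong refl)
      (auto simp: Dxn_mult sum_distrib_left Dxn_Dxn intro!: sum.cong)
  also have "\<dots> = (\<Sum>d\<le>r. \<Sum>k=d..r.
      of_real ((\<alpha> gchoose k) * of_nat (k choose d) * (\<beta> gchoose (r - k))) * ?F d)"
  proof -
    have "(SIGMA k:{..r}. {..k}) = (\<lambda>(d, k). (k, d)) ` (SIGMA d:{..r}. {d..r})"
      by force
    then show ?thesis
      by (simp add: sum.Sigma sum.reindex inj_on_def case_prod_unfold)
  qed
  also have "\<dots> = (\<Sum>d\<le>r. of_real (\<Sum>k=d..r.
      (\<alpha> gchoose k) * of_nat (k choose d) * (\<beta> gchoose (r - k))) * ?F d)"
    by (simp add: sum_distrib_right)
  also have "\<dots> = (\<Sum>d\<le>r. of_real ((\<alpha> gchoose d) * ((\<alpha> + \<beta> - of_nat d) gchoose (r - d))) * ?F d)"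
    by (intro sum.cong refl) (simp add: gbinomial_compose)
  finally show ?thesis by (simp add: mult_ac)
qed

lemma pdo_mult_assoc:
  fixes p q r :: "'a::differential_algebra pdo"
  shows "p * q * r = p * (q * r)"
proof (rule pdo_eqI)
  fix n
  obtain A where A: "\<And>n. n > A \<Longrightarrow> pcoeff p n = 0" using pcoeff_bound[of p] by blast
  obtain B where B: "\<And>n. n > B \<Longrightarrow> pcoeff q n = 0" using pcoeff_bound[of q] by blast
  obtain C where C: "\<And>n. n > C \<Longrightarrow> pcoeff r n = 0" using pcoeff_bound[of r] by blast
  have AB: "\<And>n. n > A + B \<Longrightarrow> pcoeff (p * q) n = 0" by (rule pcoeff_mult_bound[OF A B])
  have BC: "\<And>n. n > B + C \<Longrightarrow> pcoeff (q * r) n = 0" by (rule pcoeff_mult_bound[OF B C])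
  have pq: "pcoeff (p * q) (A + B - int t) = (\<Sum>(m, l, k)\<in>triples t.
      of_real (of_int (A - int m) gchoose k) * pcoeff p (A - int m) * (Dx ^^ k) (pcoeff q (B - int l)))" for t
    by (rule pcoeff_mult) (use A B in auto)
  have qr: "pcoeff (q * r) (B + C - int t) = (\<Sum>(m, l, k)\<in>triples t.
      of_real (of_int (B - int m) gchoose k) * pcoeff q (B - int m) * (Dx ^^ k) (pcoeff r (C - int l)))" for t
    by (rule pcoeff_mult) (use B C in auto)
  show "pcoeff (p * q * r) n = pcoeff (p * (q * r)) n"
  proof (cases "n > A + B + C")
    case True
    have "pcoeff (p * q * r) n = 0"
      by (rule pcoeff_mult_bound[where A = "A + B" and B = C, OF AB C]) (use True in auto)
    moreover have "pcoeff (p * (q * r)) n = 0"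
      by (rule pcoeff_mult_bound[where A = A and B = "B + C", OF A BC]) (use True in auto)
    ultimately show ?thesis by simp
  next
    case False
    define s where "s = nat (A + B + C - n)"
    have n: "n = A + B + C - int s" "n = A + (B + C) - int s" using False by (auto simp: s_def)
    let ?a = "\<lambda>m. pcoeff p (A - int m)" and ?b = "\<lambda>m. pcoeff q (B - int m)"
      and ?c = "\<lambda>m. pcoeff r (C - int m)"
    let ?f = "\<lambda>m l l' k k'. of_real (of_int (A + B - int (m + l + k)) gchoose k') *
      (of_real (of_int (A - int m) gchoose k) * ?a m * (Dx ^^ k) (?b l)) * (Dx ^^ k') (?c l')"
    let ?g = "\<lambda>m l l' k k'. of_real (of_int (A - int m) gchoose k) * ?a m *
      (Dx ^^ k) (of_real (of_int (B - int l) gchoose k') * ?b l * (Dx ^^ k') (?c l'))"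
    have "pcoeff (p * q * r) n = (\<Sum>(t, l', k')\<in>triples s.
        of_real (of_int (A + B - int t) gchoose k') * pcoeff (p * q) (A + B - int t) * (Dx ^^ k') (?c l'))"
      unfolding n(1) by (rule pcoeff_mult[OF AB C])
    also have "\<dots> = (\<Sum>(t, l', k')\<in>triples s. \<Sum>(m, l, k)\<in>triples t. ?f m l l' k k')"
      unfolding pq
      by (intro sum.cong refl)
        (auto simp: sum_distrib_left sum_distrib_right case_prod_unfold triples_def intro!: sum.cong)
    also have "\<dots> = (\<Sum>(m, t, r)\<in>triples s. \<Sum>(l, l')\<in>{(l, l'). l + l' = t}.
        \<Sum>k\<le>r. ?f m l l' k (r - k))"
      by (rule sum_triples_assoc_left)
    also have "\<dots> = (\<Sum>(m, t, r)\<in>triples s. \<Sum>(l, l')\<in>{(l, l'). l + l' = t}.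
        \<Sum>k\<le>r. ?g m l l' k (r - k))"
    proof -
      have "(\<Sum>k\<le>r. ?f m l l' k (r - k)) = (\<Sum>k\<le>r. ?g m l l' k (r - k))" for m l l' r
      proof -
        have "(\<Sum>k\<le>r. ?f m l l' k (r - k)) = ?a m *
          (\<Sum>k\<le>r. of_real ((of_int (A - int m) + of_int (B - int l) - of_nat k) gchoose (r - k)) *
             of_real (of_int (A - int m) gchoose k) * (Dx ^^ k) (?b l) * (Dx ^^ (r - k)) (?c l'))"
          unfolding sum_distrib_left
          by (intro sum.cong refl) (simp add: algebra_simps)
        also have "\<dots> = (\<Sum>k\<le>r. ?g m l l' k (r - k))"
          unfolding Leibniz_compose sum_distrib_left
          by (intro sum.cong refl) (simp only: mult.assoc Dxn_of_real_mult, simp only: mult_ac)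
        finally show ?thesis .
      qed
      then show ?thesis by simp
    qed
    also have "\<dots> = (\<Sum>(m, t, k)\<in>triples s. \<Sum>(l, l', k')\<in>triples t. ?g m l l' k k')"
      by (rule sum_triples_assoc_right[symmetric])
    also have "\<dots> = (\<Sum>(m, t, k)\<in>triples s.
        of_real (of_int (A - int m) gchoose k) * ?a m * (Dx ^^ k) (pcoeff (q * r) (B + C - int t)))"
      unfolding qr
      by (intro sum.cong refl)
        (auto simp: sum_distrib_left Dxn_sum case_prod_unfold intro!: sum.cong)
    also have "\<dots> = pcoeff (p * (q * r)) n"
      unfolding n(2) by (rule pcoeff_mult[OF A BC, symmetric])
    finally show ?thesis .
  qed
qed

lemma pdo_mult_eqI:
  fixes p q p' q' p'' q'' :: "'a::differential_algebra pdo"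
  assumes "\<And>A B s. \<lbrakk>\<And>n. n > A \<Longrightarrow> pcoeff p n = 0; \<And>n. n > B \<Longrightarrow> pcoeff q n = 0;
      \<And>n. n > A \<Longrightarrow> pcoeff p' n = 0; \<And>n. n > B \<Longrightarrow> pcoeff q' n = 0\<rbrakk> \<Longrightarrow> P (A + B - int s)"
  shows "P n"
proof -
  obtain A where A: "\<And>n. n > A \<Longrightarrow> pcoeff p n = 0" using pcoeff_bound[of p] by blast
  obtain B where B: "\<And>n. n > B \<Longrightarrow> pcoeff q n = 0" using pcoeff_bound[of q] by blast
  obtain A' where A': "\<And>n. n > A' \<Longrightarrow> pcoeff p' n = 0" using pcoeff_bound[of p'] by blast
  obtain B' where B': "\<And>n. n > B' \<Longrightarrow> pcoeff q' n = 0" using pcoeff_bound[of q'] by blast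
  define N where "N = max B B'"
  define M where "M = max (max A A') (n - N)"
  have "P (M + N - int (nat (M + N - n)))"
    by (rule assms) (auto simp: M_def N_def A B A' B')
  moreover have "M + N - int (nat (M + N - n)) = n" by (auto simp: M_def)
  ultimately show ?thesis by simp
qed

instance pdo :: (differential_algebra) ring_1
proof
  fix a b c :: "'a pdo"
  show "a * b * c = a * (b * c)" by (rule pdo_mult_assoc)
  show "a + b + c = a + (b + c)" by (rule pdo_eqI) (simp add: add.assoc)
  show "a + b = b + a" by (rule pdo_eqI) (simp add: add.commute)
  show "0 + a = a" by (rule pdo_eqI) simp
  show "- a + a = 0" by (rule pdo_eqI) simp
  show "a - b = a + - b" by (rule pdo_eqI) simp
  show "(0 :: 'a pdo) \<noteq> 1"
    by (metis (full_types) of_bool_eq(2) pcoeff_one pcoeff_zero zero_neq_one)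
  show "1 * a = a"
  proof (rule pdo_eqI)
    fix n
    obtain A where A: "\<And>n. n > A \<Longrightarrow> pcoeff a n = 0" using pcoeff_bound[of a] by blast
    have one: "\<And>n. n > 0 \<Longrightarrow> pcoeff (1 :: 'a pdo) n = 0" by (simp add: pcoeff_one)
    show "pcoeff (1 * a) n = pcoeff a n"
    proof (cases "n > A")
      case True
      have "pcoeff (1 * a) n = 0"
        by (rule pcoeff_mult_bound[OF one A]) (use True in auto)
      then show ?thesis using A True by simp
    next
      case False
      then have n: "n = 0 + A - int (nat (A - n))" by simp
      let ?s = "nat (A - n)"
      have "pcoeff (1 * a) (0 + A - int ?s) = (\<Sum>(m, l, k)\<in>triples ?s.
         of_real (of_int (0 - int m) gchoose k) * pcoeff 1 (0 - int m) * (Dx ^^ k) (pcoeff a (A - int l)))"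
        by (rule pcoeff_mult[OF one A])
      also have "\<dots> = (\<Sum>(m, l, k)\<in>{(0, ?s, 0)}.
         of_real (of_int (0 - int m) gchoose k) * pcoeff 1 (0 - int m) * (Dx ^^ k) (pcoeff a (A - int l)))"
      proof (rule sum.mono_neutral_right)
        show "\<forall>i\<in>triples ?s - {(0, ?s, 0)}. (case i of (m, l, k) \<Rightarrow>
           of_real (of_int (0 - int m) gchoose k) * pcoeff 1 (0 - int m) * (Dx ^^ k) (pcoeff a (A - int l))) = 0"
          by (auto simp: triples_def pcoeff_one gbinomial_0_left of_bool_def split: if_splits)
      qed (simp, simp add: triples_def)
      also have "\<dots> = pcoeff a n" using False by (simp add: pcoeff_one)
      finally show ?thesis using n by simp
    qed
  qed
  show "a * 1 = a"
  proof (rule pdo_eqI)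
    fix n
    obtain A where A: "\<And>n. n > A \<Longrightarrow> pcoeff a n = 0" using pcoeff_bound[of a] by blast
    have one: "\<And>n. n > 0 \<Longrightarrow> pcoeff (1 :: 'a pdo) n = 0" by (simp add: pcoeff_one)
    show "pcoeff (a * 1) n = pcoeff a n"
    proof (cases "n > A")
      case True
      have "pcoeff (a * 1) n = 0"
        by (rule pcoeff_mult_bound[OF A one]) (use True in auto)
      then show ?thesis using A True by simp
    next
      case False
      then have n: "n = A + 0 - int (nat (A - n))" by simp
      let ?s = "nat (A - n)"
      have "pcoeff (a * 1) (A + 0 - int ?s) = (\<Sum>(m, l, k)\<in>triples ?s.
         of_real (of_int (A - int m) gchoose k) * pcoeff a (A - int m) * (Dx ^^ k) (pcoeff 1 (0 - int l)))"
        by (rule pcoeff_mult[OF A one])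
      also have "\<dots> = (\<Sum>(m, l, k)\<in>{(?s, 0, 0)}.
         of_real (of_int (A - int m) gchoose k) * pcoeff a (A - int m) * (Dx ^^ k) (pcoeff 1 (0 - int l)))"
      proof (rule sum.mono_neutral_right)
        show "\<forall>i\<in>triples ?s - {(?s, 0, 0)}. (case i of (m, l, k) \<Rightarrow>
           of_real (of_int (A - int m) gchoose k) * pcoeff a (A - int m) * (Dx ^^ k) (pcoeff 1 (0 - int l))) = 0"
          by (auto simp: triples_def pcoeff_one Dxn_one of_bool_def split: if_splits)
      qed (simp, simp add: triples_def)
      also have "\<dots> = pcoeff a n" using False by (simp add: pcoeff_one)
      finally show ?thesis using n by simp
    qed
  qed
  show "(a + b) * c = a * c + b * c"
  proof (rule pdo_eqI)
    fix n
    show "pcoeff ((a + b) * c) n = pcoeff (a * c + b * c) n"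
    proof (rule pdo_mult_eqI[of a c b c], goal_cases)
      case (1 A B s)
      let ?S = "\<lambda>p q :: 'a pdo. \<Sum>(m, l, k)\<in>triples s. of_real (of_int (A - int m) gchoose k) *
        pcoeff p (A - int m) * (Dx ^^ k) (pcoeff q (B - int l))"
      have e1: "pcoeff ((a + b) * c) (A + B - int s) = ?S (a + b) c"
        by (rule pcoeff_mult) (use 1 in auto)
      have e2: "pcoeff (a * c) (A + B - int s) = ?S a c"
        by (rule pcoeff_mult) (use 1 in auto)
      have e3: "pcoeff (b * c) (A + B - int s) = ?S b c"
        by (rule pcoeff_mult) (use 1 in auto)
      show ?case
        unfolding pcoeff_add e1 e2 e3
        by (auto simp: sum.distrib[symmetric] algebra_simps intro!: sum.cong)
    qed
  qed
  show "a * (b + c) = a * b + a * c"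
  proof (rule pdo_eqI)
    fix n
    show "pcoeff (a * (b + c)) n = pcoeff (a * b + a * c) n"
    proof (rule pdo_mult_eqI[of a b a c], goal_cases)
      case (1 A B s)
      let ?S = "\<lambda>p q :: 'a pdo. \<Sum>(m, l, k)\<in>triples s. of_real (of_int (A - int m) gchoose k) *
        pcoeff p (A - int m) * (Dx ^^ k) (pcoeff q (B - int l))"
      have e1: "pcoeff (a * (b + c)) (A + B - int s) = ?S a (b + c)"
        by (rule pcoeff_mult) (use 1 in auto)
      have e2: "pcoeff (a * b) (A + B - int s) = ?S a b"
        by (rule pcoeff_mult) (use 1 in auto)
      have e3: "pcoeff (a * c) (A + B - int s) = ?S a c"
        by (rule pcoeff_mult) (use 1 in auto)
      show ?case
        unfolding pcoeff_add e1 e2 e3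
        by (auto simp: sum.distrib[symmetric] algebra_simps Dxn_add intro!: sum.cong)
    qed
  qed
qed


subsection \<open>Multiplication operators, powers of the derivation, adjoints\<close>

lift_definition mop :: "'a::differential_algebra \<Rightarrow> 'a pdo" ("\<langle>_\<rangle>")
  is "\<lambda>f (n :: int). if n = 0 then f else 0"
  by (auto intro!: exI[of _ 0])

lift_definition dxpow :: "int \<Rightarrow> 'a::differential_algebra pdo"
  is "\<lambda>m n. of_bool (n = m)"
  by (auto intro!: exI)

abbreviation dx :: "'a::differential_algebra pdo" where "dx \<equiv> dxpow 1"
abbreviation dx_inv :: "'a::differential_algebra pdo" where "dx_inv \<equiv> dxpow (- 1)"

lemma pcoeff_times:
  fixes p q :: "'a::differential_algebra pdo"
  shows "pcoeff (p * q) n = (\<Sum>(i, j)\<in>{(i, j). pcoeff p i \<noteq> 0 \<and> pcoeff q j \<noteq> 0 \<and> n \<le> i + j}.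
    of_real (of_int i gchoose nat (i + j - n)) * pcoeff p i * (Dx ^^ nat (i + j - n)) (pcoeff q j))"
  by transfer simp

lemma pcoeff_mop: "pcoeff \<langle>f\<rangle> n = (if n = 0 then f else 0)"
  by transfer simp

lemma pcoeff_dxpow: "pcoeff (dxpow m) n = of_bool (n = m)"
  by transfer simp

lemma pcoeff_mop_mult: "pcoeff (\<langle>f\<rangle> * q) n = f * pcoeff q n"
proof -
  let ?S = "{(i, j). pcoeff \<langle>f\<rangle> i \<noteq> 0 \<and> pcoeff q j \<noteq> 0 \<and> n \<le> i + j}"
  have "?S \<subseteq> {0} \<times> {j. pcoeff q j \<noteq> 0 \<and> n \<le> j}"
    by (auto simp: pcoeff_mop split: if_splits)
  moreover obtain N where N: "\<And>j. j > N \<Longrightarrow> pcoeff q j = 0" using pcoeff_bound[of q] by blast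
  then have "{j. pcoeff q j \<noteq> 0 \<and> n \<le> j} \<subseteq> {n..N}" by (auto simp: not_less[symmetric])
  then have "finite {j. pcoeff q j \<noteq> 0 \<and> n \<le> j}" by (rule finite_subset) simp
  ultimately have fin: "finite ?S" by (meson finite.emptyI finite_insert finite_SigmaI finite_subset)
  have "pcoeff (\<langle>f\<rangle> * q) n = (\<Sum>(i, j)\<in>?S \<inter> {(0, n)}. of_real (of_int i gchoose nat (i + j - n)) *
      pcoeff \<langle>f\<rangle> i * (Dx ^^ nat (i + j - n)) (pcoeff q j))"
    unfolding pcoeff_times using fin
    by (intro sum.mono_neutral_right)
      (auto simp: pcoeff_mop gbinomial_0_left split: if_splits)
  also have "\<dots> = (\<Sum>(i, j)\<in>{(0, n)}. of_real (of_int i gchoose nat (i + j - n)) *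
      pcoeff \<langle>f\<rangle> i * (Dx ^^ nat (i + j - n)) (pcoeff q j))"
    by (intro sum.mono_neutral_left) (auto simp: pcoeff_mop)
  finally show ?thesis by (simp add: pcoeff_mop)
qed

lemma pcoeff_mult_dxpow: "pcoeff (p * dxpow m) n = pcoeff p (n - m)"
proof -
  let ?S = "{(i, j). pcoeff p i \<noteq> 0 \<and> pcoeff (dxpow m :: 'a pdo) j \<noteq> 0 \<and> n \<le> i + j}"
  have "?S \<subseteq> {i. pcoeff p i \<noteq> 0 \<and> n - m \<le> i} \<times> {m}"
    by (auto simp: pcoeff_dxpow split: if_splits)
  moreover obtain N where N: "\<And>j. j > N \<Longrightarrow> pcoeff p j = 0" using pcoeff_bound[of p] by blast
  then have "{i. pcoeff p i \<noteq> 0 \<and> n - m \<le> i} \<subseteq> {n - m..N}" by (auto simp: not_less[symmetric])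
  then have "finite {i. pcoeff p i \<noteq> 0 \<and> n - m \<le> i}" by (rule finite_subset) simp
  ultimately have fin: "finite ?S" by (meson finite.emptyI finite_insert finite_SigmaI finite_subset)
  have "pcoeff (p * dxpow m) n = (\<Sum>(i, j)\<in>?S \<inter> {(n - m, m)}. of_real (of_int i gchoose nat (i + j - n)) *
      pcoeff p i * (Dx ^^ nat (i + j - n)) (pcoeff (dxpow m) j))"
    unfolding pcoeff_times using fin
    by (intro sum.mono_neutral_right)
      (auto simp: pcoeff_dxpow Dxn_one of_bool_def split: if_splits)
  also have "\<dots> = (\<Sum>(i, j)\<in>{(n - m, m)}. of_real (of_int i gchoose nat (i + j - n)) *
      pcoeff p i * (Dx ^^ nat (i + j - n)) (pcoeff (dxpow m) j))"
    by (intro sum.mono_neutral_left) (auto simp: pcoeff_dxpow)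
  finally show ?thesis by (simp add: pcoeff_dxpow)
qed

lemma mop_mult: "\<langle>f\<rangle> * \<langle>g\<rangle> = \<langle>f * g\<rangle>"
  by (rule pdo_eqI) (simp add: pcoeff_mop_mult pcoeff_mop)

lemma mop_one: "\<langle>1\<rangle> = 1"
  by (rule pdo_eqI) (simp add: pcoeff_one pcoeff_mop)

lemma dxpow_zero: "dxpow 0 = 1"
  by (rule pdo_eqI) (simp add: pcoeff_one pcoeff_dxpow)

lemma dxpow_mult: "dxpow m * dxpow n = dxpow (m + n)"
  by (rule pdo_eqI) (auto simp: pcoeff_mult_dxpow pcoeff_dxpow)

lemma dx_mult_mop: "dx * \<langle>f\<rangle> = \<langle>f\<rangle> * dx + \<langle>Dx f\<rangle>"
proof (rule pdo_eqI)
  fix n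
  have "pcoeff (dx * \<langle>f\<rangle>) n = (\<Sum>(i, j)\<in>{(i, j). pcoeff (dx :: 'a pdo) i \<noteq> 0 \<and> pcoeff \<langle>f\<rangle> j \<noteq> 0 \<and> n \<le> i + j}.
      of_real (of_int i gchoose nat (i + j - n)) * pcoeff dx i * (Dx ^^ nat (i + j - n)) (pcoeff \<langle>f\<rangle> j))"
    by (rule pcoeff_times)
  also have "{(i, j). pcoeff (dx :: 'a pdo) i \<noteq> 0 \<and> pcoeff \<langle>f\<rangle> j \<noteq> 0 \<and> n \<le> i + j}
      = (if f \<noteq> 0 \<and> n \<le> 1 then {(1, 0)} else {})"
    by (auto simp: pcoeff_dxpow pcoeff_mop)
  finally have eq: "pcoeff (dx * \<langle>f\<rangle>) n
      = (if n \<le> 1 then of_real (1 gchoose nat (1 - n)) * (Dx ^^ nat (1 - n)) f else 0)"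
    by (simp add: pcoeff_dxpow pcoeff_mop)
  consider "n > 1" | "n = 1" | "n = 0" | "n < 0" by linarith
  then show "pcoeff (dx * \<langle>f\<rangle>) n = pcoeff (\<langle>f\<rangle> * dx + \<langle>Dx f\<rangle>) n"
  proof cases
    case 4
    then have "nat (1 - n) > 1" by linarith
    then have "(1 :: real) gchoose nat (1 - n) = 0"
      using binomial_gbinomial[of 1 "nat (1 - n)", where 'a = real] by (simp add: binomial_eq_0)
    with 4 show ?thesis by (simp add: eq pcoeff_mult_dxpow pcoeff_mop)
  qed (use eq in \<open>auto simp: pcoeff_mult_dxpow pcoeff_mop\<close>)
qed

text \<open>The formal inverse of \<open>\<partial>\<^sub>y = \<omega>\<^sup>-\<^sup>1 \<partial>\<^sub>x\<close> exists.\<close>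

lemma dy_inverse:
  assumes "\<omega> * \<omega>' = 1"
  shows "(\<langle>\<omega>'\<rangle> * dx) * (dx_inv * \<langle>\<omega>\<rangle>) = 1" and "(dx_inv * \<langle>\<omega>\<rangle>) * (\<langle>\<omega>'\<rangle> * dx) = 1"
proof -
  have "(\<langle>\<omega>'\<rangle> * dx) * (dx_inv * \<langle>\<omega>\<rangle>) = \<langle>\<omega>'\<rangle> * (dx * dx_inv) * \<langle>\<omega>\<rangle>"
    by (simp add: mult.assoc)
  then show "(\<langle>\<omega>'\<rangle> * dx) * (dx_inv * \<langle>\<omega>\<rangle>) = 1"
    using assms by (simp add: dxpow_mult dxpow_zero mop_mult mop_one mult.commute)
  have "(dx_inv * \<langle>\<omega>\<rangle>) * (\<langle>\<omega>'\<rangle> * dx) = dx_inv * (\<langle>\<omega>\<rangle> * \<langle>\<omega>'\<rangle>) * dx"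
    by (simp add: mult.assoc)
  then show "(dx_inv * \<langle>\<omega>\<rangle>) * (\<langle>\<omega>'\<rangle> * dx) = 1"
    using assms by (simp add: dxpow_mult dxpow_zero mop_mult mop_one)
qed

text \<open>
  The formal \<open>L\<^sup>2(dx)\<close> adjoint of \<open>\<Sum>\<^sub>i a i \<partial>\<^sub>x\<^sup>i\<close> is \<open>\<Sum>\<^sub>i (- \<partial>\<^sub>x)\<^sup>i \<circ> a i\<close>, expanded by the Leibniz
  rule. The index set is finite.
\<close>

lift_definition adj :: "'a::differential_algebra pdo \<Rightarrow> 'a pdo" is
  "\<lambda>(p :: int \<Rightarrow> 'a) (n :: int). \<Sum>i | p i \<noteq> 0 \<and> n \<le> i.
     (if even i then 1 else - 1) * of_real (of_int i gchoose nat (i - n)) * (Dx ^^ nat (i - n)) (p i)"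
proof -
  fix p :: "int \<Rightarrow> 'a"
  assume "\<exists>N. \<forall>n>N. p n = 0"
  then obtain N where N: "\<forall>n>N. p n = 0" by blast
  then have "{i. p i \<noteq> 0 \<and> n \<le> i} = {}" if "n > N" for n
    using that by force
  then show "\<exists>N. \<forall>n>N. (\<Sum>i | p i \<noteq> 0 \<and> n \<le> i. (if even i then 1 else - 1) *
     of_real (of_int i gchoose nat (i - n)) * (Dx ^^ nat (i - n)) (p i)) = 0"
    by (intro exI[of _ N] allI impI) (simp only: sum.empty)
qed

definition madj :: "'a::differential_algebra pdo ^ 'n ^ 'm \<Rightarrow> 'a pdo ^ 'm ^ 'n" where
  "madj T = (\<chi> i j. adj (T $ j $ i))"


section \<open>Change of variables\<close>

text \<open>The Frechet derivative of \<open>f\<close> with respect to the \<open>j\<close>-th dependent variable.\<close>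

definition frechet :: "('n \<Rightarrow> nat \<Rightarrow> 'a \<Rightarrow> 'a) \<Rightarrow> 'a::differential_algebra \<Rightarrow> 'n \<Rightarrow> 'a pdo" where
  "frechet pd f j = (\<Sum>n | pd j n f \<noteq> 0. \<langle>pd j n f\<rangle> * dx ^ n)"

text \<open>
  The Frechet derivative of the nonlocal function \<open>I = \<integral>\<^sup>x \<Lambda> d\<xi>\<close>, which is not itself an element of
  the differential algebra; differentiation commutes with the formal integration.
\<close>

definition frechet_integral ::
    "('n \<Rightarrow> nat \<Rightarrow> 'a \<Rightarrow> 'a) \<Rightarrow> 'a::differential_algebra \<Rightarrow> 'n \<Rightarrow> 'a pdo" where
  "frechet_integral pd \<Lambda> j = dx_inv * frechet pd \<Lambda> j"

definition transfer_matrix ::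
    "('n \<Rightarrow> nat \<Rightarrow> 'a \<Rightarrow> 'a) \<Rightarrow> 'a::differential_algebra \<Rightarrow> 'a ^ 'n \<Rightarrow> 'a pdo ^ 'n ^ 'n" where
  "transfer_matrix pd \<Lambda> F =
     (\<chi> i j. \<langle>\<Lambda>\<rangle> * frechet pd (F $ i) j - \<langle>Dx (F $ i)\<rangle> * frechet_integral pd \<Lambda> j)"

text \<open>
  The operator into which \<open>D\<close> is converted by \<open>y = \<integral>\<^sup>x \<Lambda> d\<xi>\<close>, \<open>Q\<^sub>i = F i\<close>. The parameter \<open>\<Lambda>'\<close> stands
  for the inverse of \<open>\<Lambda>\<close>.
\<close>

definition converted :: "('n::finite \<Rightarrow> nat \<Rightarrow> 'a \<Rightarrow> 'a) \<Rightarrow> 'a::differential_algebra \<Rightarrow> 'a \<Rightarrow>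
    'a ^ 'n \<Rightarrow> 'a pdo ^ 'n ^ 'n \<Rightarrow> 'a pdo ^ 'n ^ 'n" where
  "converted pd \<Lambda> \<Lambda>' F D =
     mat \<langle>\<Lambda>'\<rangle> ** transfer_matrix pd \<Lambda> F ** D ** madj (transfer_matrix pd \<Lambda> F)"

end

theory Submission
  imports Defs
begin

text \<open>
  Write \<open>a = (2\<omega>\<inverse>, P)\<close> for the row of partial derivatives of \<open>\<omega>\<close>, so that the Frechet derivative of
  \<open>\<omega>\<close> is multiplication by \<open>a\<close>. As \<open>Q = \<omega>\<inverse> + (\<omega>\<inverse>)\<^sub>x\<close>, every Frechet derivative in play factors
  through \<open>a\<close>, and with \<open>\<X> = \<partial>\<^sub>y (\<partial>\<^sub>y + Q) \<partial>\<^sub>y\<inverse>\<close> and \<open>\<Z> = P\<^sub>y \<partial>\<^sub>y\<inverse> + P = \<partial>\<^sub>y P \<partial>\<^sub>y\<inverse>\<close> the rows of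
  \<open>\<omega>\<inverse> \<^bold>T\<close> are \<open>- \<X> \<omega>\<inverse> a\<close> and \<open>- \<omega>\<inverse> (0, 1) - \<Z> \<omega>\<inverse> a\<close>. Since \<open>\<partial>\<^sub>y\<close> is skew for \<open>dy = \<omega> dx\<close> and
  \<open>\<O> = (Q - \<partial>\<^sub>y) \<partial>\<^sub>y\<close>, the columns of \<open>\<^bold>T\<^sup>*\<close> are \<open>- a \<partial>\<^sub>y\<inverse> \<O>\<close> and \<open>- (0, 1) - a \<partial>\<^sub>y\<inverse> P \<partial>\<^sub>y\<close>. The
  products then collapse by \<open>\<omega>\<^sup>-\<^sup>2 (\<partial>\<^sub>x - \<partial>\<^sub>x\<^sup>2) = \<O>\<close>, \<open>\<omega>\<inverse> (\<partial>\<^sub>x + \<partial>\<^sub>x\<^sup>2) \<omega>\<inverse> = \<X> \<partial>\<^sub>y\<close> and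
  \<open>\<K> a = (\<omega>\<^sup>2 \<partial>\<^sub>y, 0)\<close>.
\<close>

section \<open>Multiplication operators and adjoints\<close>

text \<open>The coefficient algebra may have zero divisors, so a factor 2 is removed by the real
  scalar action.\<close>

lemma double_cancel:
  fixes f g :: "'a::real_vector"
  assumes "f + f = g + g"
  shows "f = g"
proof -
  have "2 *\<^sub>R f = 2 *\<^sub>R g"
    using assms by (simp only: scaleR_2)
  then show ?thesis
    by (simp only: scaleR_cancel_left) simp
qed

lemma pdo_double_cancel:
  fixes p q :: "'a::differential_algebra pdo"
  assumes "2 * p = 2 * q"
  shows "p = q"
proof (rule pdo_eqI)
  fix n
  have "pcoeff (p + p) n = pcoeff (q + q) n"
    using assms by (simp only: mult_2)
  then show "pcoeff p n = pcoeff q n"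
    unfolding pcoeff_add by (rule double_cancel)
qed

lemma Dx_uminus: "Dx (- f) = - Dx f"
proof -
  have "Dx (- f) + Dx f = 0"
    by (simp flip: Dx_add)
  then show ?thesis
    by (simp only: eq_neg_iff_add_eq_0)
qed

section \<open>Algebra of multiplication operators\<close>

lemma mop_add: "\<langle>f + g\<rangle> = \<langle>f\<rangle> + \<langle>g\<rangle>"
  by (rule pdo_eqI) (simp add: pcoeff_mop)

lemma mop_diff: "\<langle>f - g\<rangle> = \<langle>f\<rangle> - \<langle>g\<rangle>"
  by (rule pdo_eqI) (simp add: pcoeff_mop)

lemma mop_uminus: "\<langle>- f\<rangle> = - \<langle>f\<rangle>"
  by (rule pdo_eqI) (simp add: pcoeff_mop)

lemma mop_zero: "\<langle>0\<rangle> = 0"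
  by (rule pdo_eqI) (simp add: pcoeff_mop)

lemma mop_numeral: "\<langle>numeral k\<rangle> = numeral k"
  by (induction k) (simp_all only: numeral.simps mop_add mop_one)

lemma mop_commute: "\<langle>f\<rangle> * \<langle>g\<rangle> = \<langle>g\<rangle> * \<langle>f\<rangle>"
  by (simp add: mop_mult mult.commute)

lemma mop_left_commute: "\<langle>f\<rangle> * (\<langle>g\<rangle> * p) = \<langle>g\<rangle> * (\<langle>f\<rangle> * p)"
  by (simp only: mult.assoc[symmetric] mop_commute[of f])

text \<open>Only two terms of the Leibniz expansion survive, because \<open>1 gchoose k\<close>
  vanishes for \<open>k > 1\<close>.\<close>

lemma pcoeff_dx_mult: "pcoeff (dx * p) n = pcoeff p (n - 1) + Dx (pcoeff p n)"
proof -
  let ?S = "{(i, j). pcoeff (dx :: 'a pdo) i \<noteq> 0 \<and> pcoeff p j \<noteq> 0 \<and> n \<le> i + j}"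
  let ?f = "\<lambda>(i, j). of_real (of_int i gchoose nat (i + j - n)) *
      pcoeff dx i * (Dx ^^ nat (i + j - n)) (pcoeff p j)"
  obtain N where N: "\<And>j. j > N \<Longrightarrow> pcoeff p j = 0" using pcoeff_bound[of p] by blast
  have "?S \<subseteq> {1} \<times> {n - 1..N}"
    using N by (auto simp: pcoeff_dxpow not_less[symmetric])
  then have fin: "finite ?S"
    by (rule finite_subset) simp
  have vanish: "(1 :: real) gchoose nat (1 + j - n) = 0" if "n \<le> 1 + j" "j \<noteq> n - 1" "j \<noteq> n" for j
  proof -
    have "nat (1 + j - n) > 1" using that by linarith
    then show ?thesis
      using binomial_gbinomial[of 1 "nat (1 + j - n)", where 'a = real] by (simp add: binomial_eq_0)
  qed
  have "pcoeff (dx * p) n = sum ?f ?S"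
    by (rule pcoeff_times)
  also have "\<dots> = sum ?f (?S \<inter> {(1, n - 1), (1, n)})"
    using fin by (intro sum.mono_neutral_right)  
      (auto simp: pcoeff_dxpow, metis mult_zero_left of_real_0 vanish)
  also have "\<dots> = sum ?f {(1, n - 1), (1, n)}"
    by (intro sum.mono_neutral_left) (auto simp: pcoeff_dxpow)
  finally show ?thesis by (simp add: pcoeff_dxpow)
qed

section \<open>The formal adjoint and its reversal of products\<close>

lemma pcoeff_adj:
  "pcoeff (adj p) n = (\<Sum>i | pcoeff p i \<noteq> 0 \<and> n \<le> i. (if even i then 1 else - 1) *
     of_real (of_int i gchoose nat (i - n)) * (Dx ^^ nat (i - n)) (pcoeff p i))"
  by transfer simp

text \<open>Replaces the support of \<open>p\<close> by an interval that depends only on an order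
  bound, so that sums for different operators can share an index set.\<close>

lemma pcoeff_adj_interval:
  assumes "\<And>i. i > N \<Longrightarrow> pcoeff p i = 0"
  shows "pcoeff (adj p) n = (\<Sum>i=n..N. (if even i then 1 else - 1) *
     of_real (of_int i gchoose nat (i - n)) * (Dx ^^ nat (i - n)) (pcoeff p i))"
  unfolding pcoeff_adj
  using assms by (intro sum.mono_neutral_left) (auto simp: not_less[symmetric])

lemma adj_add: "adj (p + q) = adj p + adj q"
proof (rule pdo_eqI)
  fix n
  obtain N M where N: "\<And>i. i > N \<Longrightarrow> pcoeff p i = 0" and M: "\<And>i. i > M \<Longrightarrow> pcoeff q i = 0"
    using pcoeff_bound[of p] pcoeff_bound[of q] by blast
  \<comment> \<open>One bound for all three operators gives the three adjoints the same range of
    summation.\<close>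
  define K where "K = max N M"
  have *: "pcoeff p i = 0" "pcoeff q i = 0" "pcoeff (p + q) i = 0" if "i > K" for i
    using that N M by (auto simp: K_def)
  show "pcoeff (adj (p + q)) n = pcoeff (adj p + adj q) n"
    by (simp add: pcoeff_adj_interval[OF *(1)] pcoeff_adj_interval[OF *(2)]
        pcoeff_adj_interval[OF *(3)] sum.distrib[symmetric] Dxn_add algebra_simps del: sum.distrib)
qed

lemma adj_uminus: "adj (- p) = - adj p"
proof -
  have "adj 0 = (0 :: 'a pdo)"
    by (rule pdo_eqI) (simp add: pcoeff_adj)
  then have "adj p + adj (- p) = 0"
    by (simp add: adj_add[symmetric])
  then show ?thesis
    by (simp add: eq_neg_iff_add_eq_0 add.commute)
qed

lemma adj_diff: "adj (p - q) = adj p - adj q"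
  using adj_add[of p "- q"] by (simp add: adj_uminus)

lemma adj_mop: "adj \<langle>f\<rangle> = \<langle>f\<rangle>"
proof (rule pdo_eqI)
  fix n
  have "pcoeff (adj \<langle>f\<rangle>) n = (\<Sum>i=n..0. (if even i then 1 else - 1) *
     of_real (of_int i gchoose nat (i - n)) * (Dx ^^ nat (i - n)) (pcoeff \<langle>f\<rangle> i))"
    by (rule pcoeff_adj_interval) (simp add: pcoeff_mop)
  also have "\<dots> = (\<Sum>i\<in>{n..0} \<inter> {0}. (if even i then 1 else - 1) *
     of_real (of_int i gchoose nat (i - n)) * (Dx ^^ nat (i - n)) (pcoeff \<langle>f\<rangle> i))"
    by (rule sum.mono_neutral_right) (auto simp: pcoeff_mop)
  also have "\<dots> = pcoeff \<langle>f\<rangle> n"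
    by (cases "n = 0"; cases "n < 0") (auto simp: pcoeff_mop gbinomial_0_left)
  finally show "pcoeff (adj \<langle>f\<rangle>) n = pcoeff \<langle>f\<rangle> n" .
qed

text \<open>One of three instances of the reversal of products. Together with the left factors
  \<open>dx_inv\<close> and \<open>\<langle>f\<rangle>\<close> below it covers the transfer matrix,
  whose entries are sums of products of such operators. On coefficients this instance is Pascal's
  rule.\<close>

lemma adj_dx_mult: "adj (dx * p) = - adj p * dx"
proof (rule pdo_eqI)
  fix n
  let ?s = "\<lambda>i. (if even (i :: int) then 1 else - 1 :: 'a)"
  obtain N where N: "\<And>i. i > N \<Longrightarrow> pcoeff p i = 0" using pcoeff_bound[of p] by blast
  have N': "pcoeff (dx * p) i = 0" if "i > N + 1" for i
    using that by (simp add: pcoeff_dx_mult N)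
  have "pcoeff (adj (dx * p)) n = (\<Sum>i=n..N + 1. ?s i * of_real (of_int i gchoose nat (i - n)) *
      (Dx ^^ nat (i - n)) (pcoeff (dx * p) i))"
    by (rule pcoeff_adj_interval[OF N'])
  also have "\<dots>
     = (\<Sum>i=n..N + 1. ?s i * of_real (of_int i gchoose nat (i - n)) * (Dx ^^ nat (i - n)) (pcoeff p (i - 1)))
     + (\<Sum>i=n..N + 1. ?s i * of_real (of_int i gchoose nat (i - n)) * (Dx ^^ Suc (nat (i - n))) (pcoeff p i))"
    unfolding sum.distrib[symmetric]
    by (intro sum.cong) (simp_all add: pcoeff_dx_mult Dxn_add funpow_swap1 algebra_simps)
  \<comment> \<open>Shifting the index by one flips the sign \<open>?s\<close> and makes the range
    start at \<open>n - 1\<close>.\<close>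
  also have "(\<Sum>i=n..N + 1. ?s i * of_real (of_int i gchoose nat (i - n)) * (Dx ^^ nat (i - n)) (pcoeff p (i - 1)))
     = (\<Sum>i=n - 1..N. - (?s i * of_real (of_int (i + 1) gchoose nat (i + 1 - n)) * (Dx ^^ nat (i + 1 - n)) (pcoeff p i)))"
    by (rule sum.reindex_bij_witness[of _ "\<lambda>i. i + 1" "\<lambda>i. i - 1"]) auto
  also have "(\<Sum>i=n..N + 1. ?s i * of_real (of_int i gchoose nat (i - n)) * (Dx ^^ Suc (nat (i - n))) (pcoeff p i))
     = (\<Sum>i=n..N. ?s i * of_real (of_int i gchoose nat (i - n)) * (Dx ^^ Suc (nat (i - n))) (pcoeff p i))"
    by (rule sum.mono_neutral_right) (auto simp: N)
  \<comment> \<open>The range is extended to match the other sum. The value 0 at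
    \<open>i = n - 1\<close> is set explicitly, because \<open>nat (i - n)\<close> truncates to 0
    there and could leave a spurious term.\<close>
  also have "\<dots> = (\<Sum>i=n - 1..N. ?s i * (if i = n - 1 then 0
      else of_real (of_int i gchoose nat (i - n)) * (Dx ^^ nat (i + 1 - n)) (pcoeff p i)))"
    by (intro sum.mono_neutral_cong_left) (auto simp: Suc_nat_eq_nat_zadd1 algebra_simps)
  also have "(\<Sum>i=n - 1..N. - (?s i * of_real (of_int (i + 1) gchoose nat (i + 1 - n)) * (Dx ^^ nat (i + 1 - n)) (pcoeff p i))) + \<dots>
    = (\<Sum>i=n - 1..N. - (?s i * of_real (of_int i gchoose nat (i - (n - 1))) * (Dx ^^ nat (i - (n - 1))) (pcoeff p i)))"
    unfolding sum.distrib[symmetric]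
  proof (intro sum.cong refl, goal_cases)
    case (1 i)
    show ?case
    proof (cases "i = n - 1")
      case False
      with 1 obtain k where k: "i = n + int k"
        by (metis add_diff_cancel_left' atLeastAtMost_iff diff_add_cancel order_le_less
            zle_iff_zadd zless_imp_add1_zle)
      then have eqs: "nat (i + 1 - n) = Suc k" "nat (i - (n - 1)) = Suc k" "nat (i - n) = k" by auto
      \<comment> \<open>Pascal's rule for a real upper argument, hence also for negative
        \<open>i\<close>.\<close>
      have "(of_int (i + 1) :: real) gchoose Suc k = (of_int i gchoose k) + (of_int i gchoose Suc k)"
        by (simp add: gbinomial_Suc_Suc)
      then show ?thesis
        using False unfolding eqs by (simp add: distrib_left distrib_right)
    qed simp
  qed
  also have "\<dots> = pcoeff (- adj p * dx) n"
    by (simp add: pcoeff_mult_dxpow pcoeff_adj_interval[OF N] sum_negf)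
  finally show "pcoeff (adj (dx * p)) n = pcoeff (- adj p * dx) n" .
qed

text \<open>This is \<open>adj_dx_mult\<close> for \<open>dx * (dx_inv * p)\<close>, composed with
  \<open>dx_inv\<close> on the right.\<close>

lemma adj_dx_inv_mult: "adj (dx_inv * p) = - adj p * dx_inv"
proof -
  have "adj p = adj (dx * (dx_inv * p))"
    by (simp add: mult.assoc[symmetric] dxpow_mult dxpow_zero)
  also have "\<dots> * dx_inv = - adj (dx_inv * p)"
    by (simp add: adj_dx_mult mult.assoc dxpow_mult dxpow_zero)
  finally show ?thesis by simp
qed

lemma pcoeff_mult_mop:
  assumes "\<And>n. n > N \<Longrightarrow> pcoeff p n = 0"
  shows "pcoeff (p * \<langle>f\<rangle>) n
    = (\<Sum>j=n..N. of_real (of_int j gchoose nat (j - n)) * pcoeff p j * (Dx ^^ nat (j - n)) f)"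
proof -
  have sub: "{(i, j). pcoeff p i \<noteq> 0 \<and> pcoeff \<langle>f\<rangle> j \<noteq> 0 \<and> n \<le> i + j} \<subseteq> {n..N} \<times> {0}"
    using assms by (auto simp: pcoeff_mop not_less[symmetric] split: if_splits)
  have "pcoeff (p * \<langle>f\<rangle>) n = (\<Sum>(i, j)\<in>{n..N} \<times> {0}. of_real (of_int i gchoose nat (i + j - n)) *
      pcoeff p i * (Dx ^^ nat (i + j - n)) (pcoeff \<langle>f\<rangle> j))"
    unfolding pcoeff_times by (intro sum.mono_neutral_left sub) auto
  also have "\<dots> = (\<Sum>j=n..N. of_real (of_int j gchoose nat (j - n)) * pcoeff p j * (Dx ^^ nat (j - n)) f)"
    by (simp add: sum.cartesian_product[symmetric] pcoeff_mop)
  finally show ?thesis .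
qed

text \<open>The right-hand side expands to a double sum over \<open>n \<le> j \<le> i\<close>. For
  fixed \<open>i = n + k\<close>, trinomial revision splits off \<open>i gchoose k\<close>, and what
  remains is the Leibniz rule for the \<open>k\<close>-th derivative of
  \<open>f * ?a i\<close>.\<close>

lemma adj_mop_mult: "adj (\<langle>f\<rangle> * p) = adj p * \<langle>f\<rangle>"
proof (rule pdo_eqI)
  fix n
  let ?s = "\<lambda>i. (if even (i :: int) then 1 else - 1 :: 'a)"
  let ?a = "pcoeff p"
  obtain N where N: "\<And>i. i > N \<Longrightarrow> ?a i = 0" using pcoeff_bound[of p] by blast
  have N1: "pcoeff (\<langle>f\<rangle> * p) i = 0" and N2: "pcoeff (adj p) i = 0" if "i > N" for i
    using that N by (simp_all add: pcoeff_mop_mult pcoeff_adj_interval[OF N])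
  let ?t = "\<lambda>i j. ?s i * (of_real (of_int i gchoose nat (i - j)) * of_real (of_int j gchoose nat (j - n)))
      * ((Dx ^^ nat (i - j)) (?a i) * (Dx ^^ nat (j - n)) f)"
  have "pcoeff (adj p * \<langle>f\<rangle>) n = (\<Sum>j=n..N. \<Sum>i=j..N. ?t i j)"
    by (simp add: pcoeff_mult_mop[OF N2] pcoeff_adj_interval[OF N] sum_distrib_left
        sum_distrib_right mult_ac)
  also have "\<dots> = (\<Sum>i=n..N. \<Sum>j=n..i. ?t i j)"
  proof -
    have "(SIGMA j:{n..N}. {j..N}) = (\<lambda>(i, j). (j, i)) ` (SIGMA i:{n..N}. {n..i})"
      by force
    then show ?thesis
      by (simp add: sum.Sigma sum.reindex inj_on_def case_prod_unfold)
  qed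
  also have "\<dots> = (\<Sum>i=n..N. ?s i * of_real (of_int i gchoose nat (i - n)) * (Dx ^^ nat (i - n)) (f * ?a i))"
  proof (intro sum.cong refl)
    fix i assume "i \<in> {n..N}"
    then obtain k where k: "i = n + int k"
      using zle_iff_zadd by auto
    have "(\<Sum>j=n..i. ?t i j) = (\<Sum>c\<le>k. ?t i (n + int c))"
      by (rule sum.reindex_bij_witness[of _ "\<lambda>c. n + int c" "\<lambda>j. nat (j - n)"]) (auto simp: k)
    also have "\<dots> = (\<Sum>c\<le>k. ?s i * of_real (of_int i gchoose k) *
        (of_nat (k choose c) * (Dx ^^ c) f * (Dx ^^ (k - c)) (?a i)))"
    proof (intro sum.cong refl)
      fix c assume "c \<in> {..k}"
      then have c: "c \<le> k" by simp
      have eqs: "nat (i - (n + int c)) = k - c" "nat (n + int c - n) = c"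
        by (auto simp: k)
      \<comment> \<open>The revision is made with \<open>k - c\<close>, the number of derivatives
        falling on \<open>?a i\<close>; symmetry of the binomial then restores
        \<open>k choose c\<close>.\<close>
      have "(of_int i gchoose k) * real (k choose (k - c))
          = (of_int i gchoose (k - c)) * (of_int i - of_nat (k - c) gchoose c)"
        using gbinomial_trinomial_revision[of "k - c" k "of_int i :: real"] c
        by (simp add: binomial_gbinomial)
      also have "of_int i - of_nat (k - c) = (of_int (n + int c) :: real)"
        using c by (simp add: k)
      finally have "(of_int i gchoose (k - c)) * (of_int (n + int c) gchoose c)
          = (of_int i gchoose k) * real (k choose c)"
        using binomial_symmetric[OF c] by simp
      from arg_cong[OF this, of "of_real :: real \<Rightarrow> 'a"]
      have e: "of_real (of_int i gchoose (k - c)) * of_real (of_int (n + int c) gchoose c)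
          = (of_real (of_int i gchoose k) * of_nat (k choose c) :: 'a)"
        by (simp only: of_real_mult of_real_of_nat_eq)
      show "?t i (n + int c) = ?s i * of_real (of_int i gchoose k) *
        (of_nat (k choose c) * (Dx ^^ c) f * (Dx ^^ (k - c)) (?a i))"
        unfolding eqs e by (simp only: mult_ac)
    qed
    also have "\<dots> = ?s i * of_real (of_int i gchoose nat (i - n)) * (Dx ^^ nat (i - n)) (f * ?a i)"
      by (simp add: Dxn_mult sum_distrib_left k)
    finally show "(\<Sum>j=n..i. ?t i j)
      = ?s i * of_real (of_int i gchoose nat (i - n)) * (Dx ^^ nat (i - n)) (f * ?a i)" .
  qed
  also have "\<dots> = pcoeff (adj (\<langle>f\<rangle> * p)) n"
    by (simp add: pcoeff_adj_interval[OF N1] pcoeff_mop_mult)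
  finally show "pcoeff (adj (\<langle>f\<rangle> * p)) n = pcoeff (adj p * \<langle>f\<rangle>) n" by simp
qed

text \<open>Integration by parts in operator form: \<open>dx_inv\<close> composed with the
  commutator of \<open>dx\<close> and \<open>\<langle>f\<rangle>\<close>.\<close>

lemma dx_inv_mop_dx: "dx_inv * \<langle>Dx f\<rangle> = \<langle>f\<rangle> - dx_inv * \<langle>f\<rangle> * dx"
proof -
  have "\<langle>Dx f\<rangle> = dx * \<langle>f\<rangle> - \<langle>f\<rangle> * dx"
    by (simp add: dx_mult_mop)
  then show ?thesis
    by (simp add: right_diff_distrib mult.assoc[symmetric] dxpow_mult dxpow_zero)
qed

section \<open>Matrix products with noncommuting entries\<close>

lemma matrix_mult_2_nth: "(A ** B) $ i $ k = A $ i $ 1 * B $ 1 $ k + A $ i $ 2 * B $ 2 $ k"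
  for A :: "'b::semiring_1 ^ 2 ^ 'm"
  by (simp add: matrix_matrix_mult_def sum_2)

lemma mat_matrix_mult_nth: "(mat c ** A) $ i $ j = c * A $ i $ j"
  for A :: "'b::ring_1 ^ 'n ^ 'm"
  by (simp add: matrix_matrix_mult_def mat_def if_distrib[of "\<lambda>x. x * _"] cong: if_cong)

section \<open>Frechet derivatives\<close>

context differential_functions
begin

text \<open>Any finite set containing the support will do, so the derivatives of several functions
  can be summed over one index set.\<close>

lemma frechet_eq:
  assumes "finite S" "\<And>n. n \<notin> S \<Longrightarrow> pd j n f = 0"
  shows "frechet pd f j = (\<Sum>n\<in>S. \<langle>pd j n f\<rangle> * dx ^ n)"
  unfolding frechet_def using assms by (intro sum.mono_neutral_left) (auto simp: mop_zero)

lemma pd_eventually_zero: "\<exists>N. \<forall>n\<ge>N. pd j n f = 0"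
proof -
  obtain N where "\<And>n. n \<in> {n. pd j n f \<noteq> 0} \<Longrightarrow> n < N"
    using pd_finite[of j f] by (meson finite_nat_set_iff_bounded)
  then show ?thesis
    by (intro exI[of _ N]) (auto simp: not_less[symmetric])
qed

lemma frechet_add: "frechet pd (f + g) j = frechet pd f j + frechet pd g j"
proof -
  let ?S = "{n. pd j n f \<noteq> 0} \<union> {n. pd j n g \<noteq> 0}"
  have fin: "finite ?S" using pd_finite by blast
  have "frechet pd h j = (\<Sum>n\<in>?S. \<langle>pd j n h\<rangle> * dx ^ n)" if "h \<in> {f, g, f + g}" for h
    using that by (intro frechet_eq fin) (auto simp: pd_add)
  then show ?thesis
    by (simp add: pd_add mop_add distrib_right sum.distrib)
qed

lemma frechet_scaleR: "frechet pd (c *\<^sub>R f) j = \<langle>of_real c\<rangle> * frechet pd f j"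
proof -
  have "frechet pd (c *\<^sub>R f) j = (\<Sum>n | pd j n f \<noteq> 0. \<langle>pd j n (c *\<^sub>R f)\<rangle> * dx ^ n)"
    by (intro frechet_eq pd_finite) (auto simp: pd_scaleR simp del: scaleR_conv_of_real)
  also have "\<dots> = (\<Sum>n | pd j n f \<noteq> 0. \<langle>of_real c\<rangle> * (\<langle>pd j n f\<rangle> * dx ^ n))"
    unfolding pd_scaleR by (simp only: scaleR_conv_of_real mop_mult[symmetric] mult.assoc)
  finally show ?thesis
    by (simp only: frechet_def sum_distrib_left)
qed

lemma frechet_mult: "frechet pd (f * g) j = \<langle>g\<rangle> * frechet pd f j + \<langle>f\<rangle> * frechet pd g j"
proof -
  let ?S = "{n. pd j n f \<noteq> 0} \<union> {n. pd j n g \<noteq> 0}"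
  have fin: "finite ?S" using pd_finite by blast
  have eq: "frechet pd h j = (\<Sum>n\<in>?S. \<langle>pd j n h\<rangle> * dx ^ n)" if "h \<in> {f, g, f * g}" for h
    using that by (intro frechet_eq fin) (auto simp: pd_mult)
  have "pd j n (f * g) = g * pd j n f + f * pd j n g" for n
    by (simp add: pd_mult mult.commute)
  then show ?thesis
    by (simp add: eq mop_add mop_mult[symmetric] distrib_right sum.distrib sum_distrib_left
        mult.assoc)
qed

lemma frechet_0: "frechet pd 0 j = 0"
  using frechet_add[of 0 0 j] by simp

lemma frechet_1: "frechet pd 1 j = 0"
  using frechet_mult[of 1 1 j] by (simp add: mop_one)

text \<open>The two summands of \<open>pd_Dx\<close> are the two terms that arise when
  \<open>dx\<close> is moved past the coefficient \<open>\<langle>pd j n f\<rangle>\<close>.\<close>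

lemma frechet_Dx: "frechet pd (Dx f) j = dx * frechet pd f j"
proof -
  obtain N where N: "\<And>n. n \<ge> N \<Longrightarrow> pd j n f = 0" using pd_eventually_zero by blast
  \<comment> \<open>The bound is \<open>Suc N\<close> because \<open>Dx\<close> can raise the
    differential order by one.\<close>
  have "frechet pd (Dx f) j = (\<Sum>n<Suc N. \<langle>pd j n (Dx f)\<rangle> * dx ^ n)"
    by (rule frechet_eq) (auto simp: pd_Dx N)
  also have "\<dots> = (\<Sum>n<Suc N. \<langle>Dx (pd j n f)\<rangle> * dx ^ n)
      + (\<Sum>n<Suc N. \<langle>if n = 0 then 0 else pd j (n - 1) f\<rangle> * dx ^ n)"
    by (simp only: pd_Dx mop_add distrib_right sum.distrib)
  also have "(\<Sum>n<Suc N. \<langle>Dx (pd j n f)\<rangle> * dx ^ n) = (\<Sum>n<N. \<langle>Dx (pd j n f)\<rangle> * dx ^ n)"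
    by (simp add: N mop_zero)
  also have "(\<Sum>n<Suc N. \<langle>if n = 0 then 0 else pd j (n - 1) f\<rangle> * dx ^ n)
      = (\<Sum>n<N. \<langle>pd j n f\<rangle> * dx ^ Suc n)"
    by (subst sum.lessThan_Suc_shift) (simp add: mop_zero)
  also have "(\<Sum>n<N. \<langle>Dx (pd j n f)\<rangle> * dx ^ n) + \<dots> = (\<Sum>n<N. dx * (\<langle>pd j n f\<rangle> * dx ^ n))"
    by (simp add: mult.assoc[symmetric] dx_mult_mop distrib_right sum.distrib add.commute)
  also have "\<dots> = dx * frechet pd f j"
    by (subst frechet_eq[of "{..<N}"]) (auto simp: N sum_distrib_left)
  finally show ?thesis .
qed

lemma frechet_jet: "frechet pd (u i) j = of_bool (i = j)"
proof -
  have "pd j n (u i) = of_bool (j = i \<and> n = 0)" for n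
    using pd_jet[of j n 0 i] by simp
  then have "frechet pd (u i) j = (\<Sum>n\<in>{0}. \<langle>pd j n (u i)\<rangle> * dx ^ n)"
    by (intro frechet_eq) simp_all
  also have "\<dots> = of_bool (i = j)"
    using pd_jet[of j 0 0 i] by (simp add: mop_one mop_zero)
  finally show ?thesis .
qed

end

section \<open>The dispersive water wave coordinates\<close>

text \<open>The hypotheses of the theorem apart from the four matrices. \<open>\<omega>\<close> is
  given only through its square and its inverse \<open>\<omega>'\<close>, so its derivatives come
  from differentiating these two relations.\<close>

locale dispersive_coordinates = differential_functions u pd
  for u :: "2 \<Rightarrow> 'a::differential_algebra" and pd +
  fixes \<rho> \<gamma> \<omega> \<omega>' Q P Qy Py :: 'a
    and dy dy_inv \<O> \<X> \<Y> :: "'a pdo"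
  assumes \<rho>_def: "\<rho> = u 1" and \<gamma>_def: "\<gamma> = u 2"
    and \<omega>_sq: "\<omega>\<^sup>2 = 4 * \<rho> - \<gamma>\<^sup>2" and \<omega>_inv: "\<omega> * \<omega>' = 1"
    and Q_def: "Q = \<omega>' * (1 - Dx \<omega> * \<omega>')" and P_def: "P = - \<gamma> * \<omega>'"
    and dy_def: "dy = \<langle>\<omega>'\<rangle> * dx" and dy_right: "dy * dy_inv = 1" and dy_left: "dy_inv * dy = 1"
    and Qy_def: "Qy = \<omega>' * Dx Q" and Py_def: "Py = \<omega>' * Dx P"
    and O_def: "\<O> = \<langle>Q\<rangle> * dy - dy\<^sup>2"
    and X_def: "\<X> = dy + \<langle>Q\<rangle> + \<langle>Qy\<rangle> * dy_inv"
    and Y_def: "\<Y> = 1 + \<langle>P\<rangle>\<^sup>2 + \<langle>Py\<rangle> * dy_inv * \<langle>P\<rangle>"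
begin

text \<open>The row \<open>a\<close> of the overview: half the gradient of
  \<open>\<omega>\<^sup>2\<close>, divided by \<open>\<omega>\<close>.\<close>

definition \<omega>_deriv :: "2 \<Rightarrow> 'a" where
  "\<omega>_deriv j = (if j = 1 then 2 * \<omega>' else P)"

section \<open>Passing between \<open>dx\<close> and \<open>dy\<close>\<close>

lemma mop_inverse: "\<langle>\<omega>\<rangle> * \<langle>\<omega>'\<rangle> = 1" "\<langle>\<omega>'\<rangle> * \<langle>\<omega>\<rangle> = 1"
  using \<omega>_inv by (simp_all add: mop_mult mop_one mult.commute)

lemma mop_inverse': "\<langle>\<omega>\<rangle> * (\<langle>\<omega>'\<rangle> * p) = p" "\<langle>\<omega>'\<rangle> * (\<langle>\<omega>\<rangle> * p) = p"
  by (simp_all add: mult.assoc[symmetric] mop_inverse)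

text \<open>Two-sided inverses are unique, so the assumed \<open>dy_inv\<close> is the concrete one
  of \<open>dy_inverse\<close>.\<close>

lemma dy_inv_eq: "dy_inv = dx_inv * \<langle>\<omega>\<rangle>"
proof -
  have "dy_inv = dx_inv * \<langle>\<omega>\<rangle> * dy * dy_inv"
    using dy_inverse(2)[OF \<omega>_inv] by (simp add: dy_def)
  then show ?thesis
    by (simp add: mult.assoc dy_right)
qed

lemma dx_eq: "dx = \<langle>\<omega>\<rangle> * dy" and dx_inv_eq: "dx_inv = dy_inv * \<langle>\<omega>'\<rangle>"
  by (simp_all add: dy_def dy_inv_eq mult.assoc mop_inverse mop_inverse')

lemma dy_mult_mop: "dy * \<langle>f\<rangle> = \<langle>f\<rangle> * dy + \<langle>\<omega>' * Dx f\<rangle>"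
proof -
  have "dy * \<langle>f\<rangle> = \<langle>\<omega>' * f\<rangle> * dx + \<langle>\<omega>' * Dx f\<rangle>"
    by (simp add: dy_def mult.assoc dx_mult_mop distrib_left mop_mult[symmetric])
  also have "\<langle>\<omega>' * f\<rangle> * dx = \<langle>f\<rangle> * dy"
    by (simp add: dy_def mult.assoc[symmetric] mop_mult mult.commute)
  finally show ?thesis .
qed

lemma dy_cancel: "dy * (dy_inv * p) = p" "dy_inv * (dy * p) = p"
  by (simp_all add: mult.assoc[symmetric] dy_right dy_left)

text \<open>Turns the nonlocal sums in \<open>\<X>\<close> and \<open>\<Y>\<close> into conjugates
  by \<open>dy\<close>, that is, into products in which \<open>dy\<close> and \<open>dy_inv\<close>
  can cancel.\<close>

lemma mop_dy_conj: "\<langle>\<omega>' * Dx f\<rangle> * dy_inv + \<langle>f\<rangle> = dy * \<langle>f\<rangle> * dy_inv"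
  by (simp add: dy_mult_mop distrib_right mult.assoc dy_right add.commute)

lemma X_eq: "\<X> = dy * (dy + \<langle>Q\<rangle>) * dy_inv"
  using mop_dy_conj[of Q]
  by (simp add: X_def Qy_def distrib_left distrib_right mult.assoc dy_right add_ac)

lemma Z_eq: "\<langle>Py\<rangle> * dy_inv + \<langle>P\<rangle> = dy * \<langle>P\<rangle> * dy_inv"
  using mop_dy_conj[of P] by (simp add: Py_def)

lemma Y_eq: "\<Y> = 1 + dy * \<langle>P\<rangle> * dy_inv * \<langle>P\<rangle>"
  by (simp add: Y_def Z_eq[symmetric] distrib_right power2_eq_square add_ac)

lemma O_eq: "\<O> = (\<langle>Q\<rangle> - dy) * dy"
  by (simp add: O_def left_diff_distrib power2_eq_square)

section \<open>\<open>\<O>\<close> and \<open>\<X>\<close> in terms of \<open>dx\<close>\<close>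

lemma Dx_\<omega>': "Dx \<omega>' = - Dx \<omega> * \<omega>'\<^sup>2"
proof -
  have "Dx \<omega> * \<omega>' + \<omega> * Dx \<omega>' = 0"
    using Dx_mult[of \<omega> \<omega>'] by (simp add: \<omega>_inv)
  then have "\<omega>' * (Dx \<omega> * \<omega>') + (\<omega> * \<omega>') * Dx \<omega>' = 0"
    by (metis distrib_left mult.assoc mult.commute mult_zero_right)
  then show ?thesis
    by (simp add: \<omega>_inv power2_eq_square algebra_simps eq_neg_iff_add_eq_0)
qed

lemma Q_eq: "Q = \<omega>' + Dx \<omega>'"
  by (simp add: Q_def Dx_\<omega>' power2_eq_square algebra_simps)

text \<open>Moving \<open>dx\<close> past \<open>\<omega>'\<close> in \<open>dy\<^sup>2\<close>
  produces a first-order term, which cancels the \<open>Dx \<omega>'\<close> part of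
  \<open>\<langle>Q\<rangle> * dy\<close>.\<close>

lemma O_x: "\<langle>\<omega>'\<rangle> * \<langle>\<omega>'\<rangle> * (dx - dx\<^sup>2) = \<O>"
proof -
  have "dy * dy = \<langle>\<omega>'\<rangle> * (dx * \<langle>\<omega>'\<rangle>) * dx"
    by (simp add: dy_def mult.assoc)
  also have "\<dots> = \<langle>\<omega>'\<rangle> * \<langle>\<omega>'\<rangle> * dx\<^sup>2 + \<langle>\<omega>'\<rangle> * \<langle>Dx \<omega>'\<rangle> * dx"
    by (simp add: dx_mult_mop algebra_simps power2_eq_square)
  also have "\<langle>\<omega>'\<rangle> * \<langle>Dx \<omega>'\<rangle> = \<langle>Dx \<omega>'\<rangle> * \<langle>\<omega>'\<rangle>"
    by (simp add: mop_mult mult.commute)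
  finally show ?thesis
    by (simp add: O_def Q_eq power2_eq_square[of dy] mop_add)
      (simp add: dy_def algebra_simps)
qed

text \<open>The factor \<open>dy + \<langle>Q\<rangle>\<close> of \<open>X_eq\<close> equals
  \<open>(1 + dx) * \<langle>\<omega>'\<rangle>\<close>, by \<open>Q_eq\<close>.\<close>

lemma X_dy: "\<langle>\<omega>'\<rangle> * (dx + dx\<^sup>2) * \<langle>\<omega>'\<rangle> = \<X> * dy"
proof -
  have "dx\<^sup>2 * \<langle>\<omega>'\<rangle> = dx * (\<langle>\<omega>'\<rangle> * dx + \<langle>Dx \<omega>'\<rangle>)"
    by (simp add: power2_eq_square dx_mult_mop mult.assoc)
  then show ?thesis
    by (simp add: X_eq mult.assoc dy_left Q_eq mop_add) (simp add: dy_def algebra_simps)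
qed

text \<open>Implicit differentiation of \<open>\<omega> * \<omega> + \<gamma> * \<gamma> = 4
  *\<^sub>R \<rho>\<close>, after which first 2 and then \<open>\<omega>\<close> is
  cancelled.\<close>

lemma frechet_\<omega>: "frechet pd \<omega> j = \<langle>\<omega>_deriv j\<rangle>"
proof -
  have eq: "\<omega> * \<omega> + \<gamma> * \<gamma> = 4 *\<^sub>R \<rho>"
    using \<omega>_sq by (simp add: power2_eq_square scaleR_conv_of_real)
  have "2 * (\<langle>\<omega>\<rangle> * frechet pd \<omega> j + \<langle>\<gamma>\<rangle> * frechet pd \<gamma> j) = 2 * (2 * frechet pd \<rho> j)"
    using arg_cong[OF eq, of "\<lambda>f. frechet pd f j"]
    by (simp add: frechet_add frechet_mult frechet_scaleR mop_numeral distrib_left)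
      (simp add: mult_2)
  then have "\<langle>\<omega>\<rangle> * frechet pd \<omega> j + \<langle>\<gamma>\<rangle> * frechet pd \<gamma> j = 2 * frechet pd \<rho> j"
    by (rule pdo_double_cancel)
  then have "\<langle>\<omega>\<rangle> * frechet pd \<omega> j = 2 * frechet pd \<rho> j - \<langle>\<gamma>\<rangle> * frechet pd \<gamma> j"
    by (simp add: eq_diff_eq)
  from arg_cong[OF this, of "\<lambda>p. \<langle>\<omega>'\<rangle> * p"]
  have F: "frechet pd \<omega> j = \<langle>\<omega>'\<rangle> * (2 * of_bool (1 = j) - \<langle>\<gamma>\<rangle> * of_bool (2 = j))"
    by (simp only: mop_inverse' \<rho>_def \<gamma>_def frechet_jet)
  consider "j = 1" | "j = 2"
    using exhaust_2 by blast
  then show ?thesis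
  proof cases
    case 1
    have "\<langle>\<omega>'\<rangle> * 2 = \<langle>2 * \<omega>'\<rangle>"
      by (simp only: mop_numeral[symmetric] mop_mult mult.commute)
    with F 1 show ?thesis
      by (simp add: \<omega>_deriv_def)
  next
    case 2
    have "\<langle>\<omega>'\<rangle> * \<langle>\<gamma>\<rangle> = - \<langle>P\<rangle>"
      by (simp add: P_def mop_mult mop_uminus mult.commute)
    with F 2 show ?thesis
      by (simp add: \<omega>_deriv_def)
  qed
qed

section \<open>The transfer matrix and its adjoint\<close>

abbreviation T :: "'a pdo ^ 2 ^ 2" where
  "T \<equiv> transfer_matrix pd \<omega> (vector [Q, P])"

lemma frechet_\<omega>': "frechet pd \<omega>' j = - (\<langle>\<omega>'\<rangle> * \<langle>\<omega>'\<rangle> * \<langle>\<omega>_deriv j\<rangle>)"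
proof -
  have "\<langle>\<omega>'\<rangle> * \<langle>\<omega>_deriv j\<rangle> + \<langle>\<omega>\<rangle> * frechet pd \<omega>' j = 0"
    using frechet_mult[of \<omega> \<omega>' j] by (simp add: \<omega>_inv frechet_1 frechet_\<omega>)
  then have "\<langle>\<omega>\<rangle> * frechet pd \<omega>' j = - (\<langle>\<omega>'\<rangle> * \<langle>\<omega>_deriv j\<rangle>)"
    by (simp add: eq_neg_iff_add_eq_0 add.commute)
  from arg_cong[OF this, of "\<lambda>p. \<langle>\<omega>'\<rangle> * p"] show ?thesis
    by (simp add: mop_inverse' mult.assoc)
qed

text \<open>Linearises \<open>\<omega> * P + \<gamma> = 0\<close> rather than the quotient, so the
  derivative of \<open>\<omega>'\<close> does not enter.\<close>

lemma frechet_P: "\<langle>\<omega>\<rangle> * frechet pd P j = - of_bool (j = 2) - \<langle>P\<rangle> * \<langle>\<omega>_deriv j\<rangle>"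
proof -
  have "\<omega> * P + \<gamma> = 0"
    using \<omega>_inv by (simp add: P_def mult.left_commute)
  from arg_cong[OF this, of "\<lambda>f. frechet pd f j"]
  have "\<langle>P\<rangle> * \<langle>\<omega>_deriv j\<rangle> + \<langle>\<omega>\<rangle> * frechet pd P j + of_bool (2 = j) = 0"
    by (simp add: frechet_add frechet_mult frechet_0 frechet_\<omega> \<gamma>_def frechet_jet)
  then show ?thesis
    by (simp add: eq_commute[of 2 j] algebra_simps eq_neg_iff_add_eq_0)
qed

text \<open>Identifies the bracket in the first row of \<open>T\<close>, which after scaling by
  \<open>\<omega>'\<close> leaves \<open>\<X>\<close>.\<close>

lemma X_x: "\<langle>\<omega>\<rangle> * \<X> * \<langle>\<omega>'\<rangle> = dx * \<langle>\<omega>'\<rangle> + \<langle>Q\<rangle> + \<langle>Dx Q\<rangle> * dx_inv"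
proof -
  have "\<langle>\<omega>\<rangle> * \<langle>Qy\<rangle> = \<langle>Dx Q\<rangle>"
    by (simp add: Qy_def mop_mult[symmetric] mop_inverse')
  moreover have "\<langle>\<omega>\<rangle> * (\<langle>Q\<rangle> * \<langle>\<omega>'\<rangle>) = \<langle>Q\<rangle>"
    by (simp add: mop_commute[of Q] mop_inverse')
  ultimately show ?thesis
    by (simp add: X_def dx_eq dx_inv_eq distrib_left distrib_right mult.assoc[symmetric])
qed

lemma T1: "T $ 1 $ j = - ((dx * \<langle>\<omega>'\<rangle> + \<langle>Q\<rangle> + \<langle>Dx Q\<rangle> * dx_inv) * \<langle>\<omega>_deriv j\<rangle>)"
proof -
  have "\<langle>\<omega>\<rangle> * frechet pd Q j
      = \<langle>\<omega>\<rangle> * (1 + dx) * (- (\<langle>\<omega>'\<rangle> * \<langle>\<omega>'\<rangle> * \<langle>\<omega>_deriv j\<rangle>))"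
    by (simp add: Q_eq frechet_add frechet_Dx frechet_\<omega>' algebra_simps)
  also have "\<dots> = - ((\<langle>\<omega>'\<rangle> + \<langle>\<omega>\<rangle> * dx * \<langle>\<omega>'\<rangle> * \<langle>\<omega>'\<rangle>) * \<langle>\<omega>_deriv j\<rangle>)"
    by (simp add: distrib_left distrib_right mult.assoc mop_inverse')
  \<comment> \<open>Moving \<open>\<omega>\<close> past \<open>dx\<close> lets it cancel one
    \<open>\<omega>'\<close>; the commutator supplies the second summand of
    \<open>Q\<close>.\<close>
  also have "\<langle>\<omega>\<rangle> * dx * \<langle>\<omega>'\<rangle> * \<langle>\<omega>'\<rangle> = dx * \<langle>\<omega>'\<rangle> - \<langle>Dx \<omega>\<rangle> * (\<langle>\<omega>'\<rangle> * \<langle>\<omega>'\<rangle>)"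
  proof -
    have "\<langle>\<omega>\<rangle> * dx = dx * \<langle>\<omega>\<rangle> - \<langle>Dx \<omega>\<rangle>"
      by (simp add: dx_mult_mop)
    then show ?thesis
      by (simp add: left_diff_distrib mult.assoc mop_inverse')
  qed
  also have "\<langle>\<omega>'\<rangle> + (dx * \<langle>\<omega>'\<rangle> - \<langle>Dx \<omega>\<rangle> * (\<langle>\<omega>'\<rangle> * \<langle>\<omega>'\<rangle>)) = dx * \<langle>\<omega>'\<rangle> + \<langle>Q\<rangle>"
    by (simp add: Q_def mop_diff mop_mult algebra_simps)
  finally show ?thesis
    by (simp add: transfer_matrix_def frechet_integral_def frechet_\<omega> vector_2
        distrib_right mult.assoc algebra_simps)
qed

lemma T2: "T $ 2 $ j = - of_bool (j = 2) - dx * \<langle>P\<rangle> * dx_inv * \<langle>\<omega>_deriv j\<rangle>"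
proof -
  \<comment> \<open>The local term from \<open>frechet_P\<close> and the nonlocal term from the
    integral defining \<open>y\<close> combine into this conjugate of
    \<open>\<langle>P\<rangle>\<close>.\<close>
  have "dx * \<langle>P\<rangle> * dx_inv = \<langle>P\<rangle> + \<langle>Dx P\<rangle> * dx_inv"
    by (simp add: dx_mult_mop distrib_right mult.assoc dxpow_mult dxpow_zero)
  then show ?thesis
    by (simp add: transfer_matrix_def frechet_integral_def frechet_\<omega> frechet_P vector_2
        distrib_right mult.assoc algebra_simps)
qed

lemma madj_T1: "madj T $ j $ 1 = - (\<langle>\<omega>_deriv j\<rangle> * dy_inv * \<O>)"
proof -
  have "madj T $ j $ 1 = \<langle>\<omega>_deriv j\<rangle> * (\<langle>\<omega>'\<rangle> * dx - \<langle>Q\<rangle> + dx_inv * \<langle>Dx Q\<rangle>)"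
    by (simp add: madj_def T1 adj_uminus adj_add adj_diff distrib_right mult.assoc mop_mult adj_dx_mult
        adj_mop adj_mop_mult adj_dx_inv_mult)
      (simp add: mop_mult[symmetric] mult.assoc algebra_simps
        mop_left_commute[of \<omega>' "\<omega>_deriv j"] mop_commute[of Q "\<omega>_deriv j"])
  \<comment> \<open>Integration by parts cancels the bare \<open>\<langle>Q\<rangle>\<close>.
    Conjugating \<open>\<langle>Q\<rangle>\<close> by \<open>dx\<close> or by \<open>dy\<close>
    gives the same operator, because multiplications commute.\<close>
  also have "\<langle>\<omega>'\<rangle> * dx - \<langle>Q\<rangle> + dx_inv * \<langle>Dx Q\<rangle> = - (dy_inv * \<O>)"
    by (simp add: dx_inv_mop_dx O_eq left_diff_distrib right_diff_distrib dy_cancel mult.assoc)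
      (simp add: dy_def dy_inv_eq mult.assoc mop_left_commute[of \<omega> Q] mop_inverse')
  finally show ?thesis
    by (simp add: mult.assoc)
qed

lemma madj_T2: "madj T $ j $ 2 = - of_bool (j = 2) - \<langle>\<omega>_deriv j\<rangle> * dy_inv * \<langle>P\<rangle> * dy"
proof -
  have adj_b: "adj (of_bool b) = (of_bool b :: 'a pdo)" for b
    using adj_mop[of "of_bool b :: 'a"] by (cases b) (simp_all add: mop_one mop_zero)
  have "madj T $ j $ 2 = - of_bool (j = 2) - \<langle>\<omega>_deriv j\<rangle> * (dx_inv * \<langle>P\<rangle> * dx)"
    by (simp add: madj_def T2 adj_uminus adj_diff adj_b mult.assoc adj_dx_mult
        adj_mop adj_mop_mult adj_dx_inv_mult)
  also have "dx_inv * \<langle>P\<rangle> * dx = dy_inv * \<langle>P\<rangle> * dy"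
    by (simp add: dy_def dy_inv_eq mult.assoc)
      (simp add: mult.assoc[symmetric], simp add: mult.assoc mop_commute[of P] mop_inverse')
  finally show ?thesis
    by (simp add: mult.assoc)
qed

lemma scaled_T1: "\<langle>\<omega>'\<rangle> * T $ 1 $ j = - (\<X> * \<langle>\<omega>'\<rangle> * \<langle>\<omega>_deriv j\<rangle>)"
  by (simp add: T1 X_x[symmetric] mult.assoc mop_inverse')

lemma scaled_T2:
  "\<langle>\<omega>'\<rangle> * T $ 2 $ j
    = - of_bool (j = 2) * \<langle>\<omega>'\<rangle> - dy * \<langle>P\<rangle> * dy_inv * \<langle>\<omega>'\<rangle> * \<langle>\<omega>_deriv j\<rangle>"
proof -
  have "dx * \<langle>P\<rangle> * dx_inv = \<langle>\<omega>\<rangle> * (dy * \<langle>P\<rangle> * dy_inv) * \<langle>\<omega>'\<rangle>"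
    by (simp only: dx_eq dx_inv_eq mult.assoc)
  then show ?thesis
    unfolding T2 by (simp only: mult.assoc mop_inverse' right_diff_distrib) (auto split: if_splits)
qed

text \<open>
  The composition of \<open>\<K>\<close> with the gradient of \<open>\<omega>\<close> kills constants: \<open>\<integral> \<omega> dx\<close> is a Casimir of \<open>\<K>\<close>.
  This is why \<open>\<J>'\<close> is so much simpler than \<open>\<K>'\<close>.
\<close>

lemma K_\<omega>_deriv:
  "(\<langle>\<rho>\<rangle> * dx + dx * \<langle>\<rho>\<rangle>) * \<langle>\<omega>_deriv 1\<rangle> + \<langle>\<gamma>\<rangle> * dx * \<langle>\<omega>_deriv 2\<rangle> = \<langle>\<omega>\<rangle> * \<langle>\<omega>\<rangle> * dy"
  "dx * \<langle>\<gamma>\<rangle> * \<langle>\<omega>_deriv 1\<rangle> + 2 * dx * \<langle>\<omega>_deriv 2\<rangle> = 0"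
proof -
  have d: "\<omega>_deriv 1 = 2 * \<omega>'" "\<omega>_deriv 2 = P"
    by (simp_all add: \<omega>_deriv_def)
  have sq: "4 * \<rho> = \<omega> * \<omega> + \<gamma> * \<gamma>"
    using \<omega>_sq by (simp add: power2_eq_square)
  \<comment> \<open>Differentiating \<open>sq\<close> gives this identity twice over;
    \<open>double_cancel\<close> halves it.\<close>
  have "Dx \<rho> + Dx \<rho> = \<omega> * Dx \<omega> + \<gamma> * Dx \<gamma>"
  proof (rule double_cancel)
    show "Dx \<rho> + Dx \<rho> + (Dx \<rho> + Dx \<rho>) = \<omega> * Dx \<omega> + \<gamma> * Dx \<gamma> + (\<omega> * Dx \<omega> + \<gamma> * Dx \<gamma>)"
      using arg_cong[OF sq, of Dx] Dxn_of_real_mult[of 1 4 \<rho>] by (simp add: Dx_add Dx_mult algebra_simps)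
  qed
  then have sq_x: "2 * Dx \<rho> = \<omega> * Dx \<omega> + \<gamma> * Dx \<gamma>"
    by simp
  have inv_x: "\<omega> * Dx \<omega>' = - Dx \<omega> * \<omega>'"
    using Dx_mult[of \<omega> \<omega>'] by (simp add: \<omega>_inv eq_neg_iff_add_eq_0 add.commute)
  have Dx2: "Dx (2 :: 'a) = 0"
    using Dx_of_real[of 2, where 'a = 'a] by simp
  \<comment> \<open>\<open>lead\<close> and \<open>const\<close> are the coefficients of
    \<open>dx\<close> and of order zero in the first component of the product; the vanishing of
    \<open>const\<close> is what makes it kill constants.\<close>
  have lead: "\<rho> * (2 * \<omega>') + \<rho> * (2 * \<omega>') + \<gamma> * P = \<omega>"
  proof -
    have "\<rho> * (2 * \<omega>') + \<rho> * (2 * \<omega>') + \<gamma> * P = 4 * \<rho> * \<omega>' - \<gamma> * \<gamma> * \<omega>'"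
      by (simp add: P_def algebra_simps)
    also have "\<dots> = \<omega> * (\<omega> * \<omega>')"
      unfolding sq by (simp add: algebra_simps)
    finally show ?thesis by (simp add: \<omega>_inv)
  qed
  have const: "\<rho> * Dx (2 * \<omega>') + Dx (\<rho> * (2 * \<omega>')) + \<gamma> * Dx P = 0"
  proof -
    have P': "P = - (\<gamma> * \<omega>')" by (simp add: P_def)
    have DP: "Dx P = - (Dx \<gamma> * \<omega>' + \<gamma> * Dx \<omega>')"
      unfolding P' Dx_uminus by (simp add: Dx_mult)
    have "\<rho> * Dx (2 * \<omega>') + Dx (\<rho> * (2 * \<omega>')) + \<gamma> * Dx P
        = (4 * \<rho>) * Dx \<omega>' + (2 * Dx \<rho>) * \<omega>' - \<gamma> * Dx \<gamma> * \<omega>' - \<gamma> * \<gamma> * Dx \<omega>'"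
      by (simp only: DP Dx_mult Dx2) (simp add: algebra_simps)
    also have "\<dots> = \<omega> * (\<omega> * Dx \<omega>') + \<omega> * Dx \<omega> * \<omega>'"
      unfolding sq sq_x by (simp add: algebra_simps)
    also have "\<dots> = 0"
      unfolding inv_x by (simp add: algebra_simps)
    finally show ?thesis .
  qed
  have mop_dx_mop: "\<langle>f\<rangle> * dx * \<langle>g\<rangle> = \<langle>f * g\<rangle> * dx + \<langle>f * Dx g\<rangle>" for f g :: 'a
    by (simp add: mult.assoc dx_mult_mop distrib_left mop_mult[symmetric])
  have dx_mop_mop: "dx * \<langle>f\<rangle> * \<langle>g\<rangle> = \<langle>f * g\<rangle> * dx + \<langle>Dx (f * g)\<rangle>" for f g :: 'a
    unfolding mult.assoc mop_mult by (rule dx_mult_mop)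
  have "(\<langle>\<rho>\<rangle> * dx + dx * \<langle>\<rho>\<rangle>) * \<langle>2 * \<omega>'\<rangle> + \<langle>\<gamma>\<rangle> * dx * \<langle>P\<rangle>
      = \<langle>\<rho> * (2 * \<omega>') + \<rho> * (2 * \<omega>') + \<gamma> * P\<rangle> * dx
        + \<langle>\<rho> * Dx (2 * \<omega>') + Dx (\<rho> * (2 * \<omega>')) + \<gamma> * Dx P\<rangle>"
    by (simp only: distrib_right mop_dx_mop dx_mop_mop mop_add add_ac)
  also have "\<dots> = \<langle>\<omega>\<rangle> * \<langle>\<omega>\<rangle> * dy"
    by (simp only: lead const mop_zero) (simp add: dy_def mult.assoc mop_inverse')
  finally show "(\<langle>\<rho>\<rangle> * dx + dx * \<langle>\<rho>\<rangle>) * \<langle>\<omega>_deriv 1\<rangle> + \<langle>\<gamma>\<rangle> * dx * \<langle>\<omega>_deriv 2\<rangle>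
      = \<langle>\<omega>\<rangle> * \<langle>\<omega>\<rangle> * dy"
    by (simp only: d)
  \<comment> \<open>The second component vanishes before \<open>dx\<close> is applied, by the choice
    of \<open>P\<close>.\<close>
  have "\<gamma> * (2 * \<omega>') + P + P = 0"
    by (simp add: P_def algebra_simps)
  then have "dx * \<langle>\<gamma> * (2 * \<omega>') + P + P\<rangle> = 0"
    by (simp add: mop_zero)
  then show "dx * \<langle>\<gamma>\<rangle> * \<langle>\<omega>_deriv 1\<rangle> + 2 * dx * \<langle>\<omega>_deriv 2\<rangle> = 0"
    by (simp only: d mop_add mop_mult mult_2 distrib_left distrib_right mult.assoc add.assoc)
qed

section \<open>The two converted operators, entry by entry\<close>

lemma converted_nth:
  "converted pd \<omega> \<omega>' (vector [Q, P]) D $ i $ k =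
    (\<langle>\<omega>'\<rangle> * T $ i $ 1) * (D $ 1 $ 1 * madj T $ 1 $ k + D $ 1 $ 2 * madj T $ 2 $ k)
    + (\<langle>\<omega>'\<rangle> * T $ i $ 2) * (D $ 2 $ 1 * madj T $ 1 $ k + D $ 2 $ 2 * madj T $ 2 $ k)"
proof -
  \<comment> \<open>This bracketing exposes the scaled rows of \<open>T\<close> on the left and the
    action of \<open>D\<close> on the adjoint columns on the right.\<close>
  have "converted pd \<omega> \<omega>' (vector [Q, P]) D = (mat \<langle>\<omega>'\<rangle> ** T) ** (D ** madj T)"
    by (simp add: converted_def matrix_mul_assoc)
  then show ?thesis
    by (simp only: matrix_mult_2_nth[of "mat \<langle>\<omega>'\<rangle> ** T"] matrix_mult_2_nth[of D]
        mat_matrix_mult_nth)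
qed

text \<open>The factor 2 is written as a sum, so that entries can be compared as sums of monomials
  without numerals.\<close>

lemma mop_\<omega>_deriv: "\<langle>\<omega>_deriv 1\<rangle> = \<langle>\<omega>'\<rangle> + \<langle>\<omega>'\<rangle>" "\<langle>\<omega>_deriv 2\<rangle> = \<langle>P\<rangle>"
proof -
  have "\<omega>_deriv 1 = \<omega>' + \<omega>'"
    by (simp add: \<omega>_deriv_def)
  then show "\<langle>\<omega>_deriv 1\<rangle> = \<langle>\<omega>'\<rangle> + \<langle>\<omega>'\<rangle>"
    by (simp only: mop_add)
qed (simp add: \<omega>_deriv_def)

lemma converted_J:
  "converted pd \<omega> \<omega>' (vector [Q, P])
      (vector [vector [0, dx - dx\<^sup>2], vector [dx + dx\<^sup>2, 0]]) =
    mat 2 ** vector [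
        vector [\<X> * (\<langle>P\<rangle> * \<X> + \<O> * \<langle>P\<rangle> * dy_inv) * \<O>,
                \<X> * (\<langle>P\<rangle> * \<X> * \<langle>P\<rangle> * dy + \<O> * (1 + \<langle>P\<rangle> * dy_inv * \<langle>P\<rangle> * dy))],
        vector [\<Y> * \<X> * \<O> + (\<langle>Py\<rangle> * dy_inv + \<langle>P\<rangle>) * \<O> * \<langle>P\<rangle> * dy_inv * \<O>,
                \<Y> * \<X> * \<langle>P\<rangle> * dy
                  + (\<langle>Py\<rangle> * dy_inv + \<langle>P\<rangle>) * \<O> * (1 + \<langle>P\<rangle> * dy_inv * \<langle>P\<rangle> * dy)]]"
    (is "?L = ?R")
proof -
  define F G where "F = (dx - dx\<^sup>2 :: 'a pdo)" and "G = (dx + dx\<^sup>2 :: 'a pdo)"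
  \<comment> \<open>The trailing factor \<open>r\<close> lets the collapse rules act inside
    right-nested products.\<close>
  have F: "\<langle>\<omega>'\<rangle> * (\<langle>\<omega>'\<rangle> * F) = \<O>" "\<langle>\<omega>'\<rangle> * (\<langle>\<omega>'\<rangle> * (F * r)) = \<O> * r" for r
    using O_x by (simp_all add: F_def mult.assoc[symmetric])
  have G: "\<langle>\<omega>'\<rangle> * (G * (\<langle>\<omega>'\<rangle> * r)) = \<X> * (dy * r)" for r
    using X_dy by (simp add: G_def mult.assoc[symmetric])
  \<comment> \<open>Moves \<open>\<omega>'\<close> rightward past \<open>P\<close> to reach
    \<open>G\<close>.\<close>
  have P: "\<langle>\<omega>'\<rangle> * (\<langle>P\<rangle> * r) = \<langle>P\<rangle> * (\<langle>\<omega>'\<rangle> * r)" for r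
    by (simp add: mult.assoc[symmetric] mop_commute[of \<omega>'])
  note nth = converted_nth mat_matrix_mult_nth vector_2 scaled_T1 scaled_T2 madj_T1 madj_T2
    mop_\<omega>_deriv Y_eq Z_eq
  have "?L $ i $ k = ?R $ i $ k" for i k
    unfolding F_def[symmetric] G_def[symmetric]
    using exhaust_2[of i] exhaust_2[of k]
    \<comment> \<open>The minus signs of rows and columns cancel in pairs, and the expanded entries
      then differ only in the order of summands.\<close>
    by (elim disjE; simp add: nth; simp add: distrib_left distrib_right right_diff_distrib
        left_diff_distrib mult.assoc mult_2 dy_cancel P F G; simp only: add_ac)
  then show ?thesis
    by (simp add: vec_eq_iff)
qed

lemma converted_K:
  "converted pd \<omega> \<omega>' (vector [Q, P])
      (vector [vector [\<langle>\<rho>\<rangle> * dx + dx * \<langle>\<rho>\<rangle>, \<langle>\<gamma>\<rangle> * dx], vector [dx * \<langle>\<gamma>\<rangle>, 2 * dx]]) =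
    mat 2 ** vector [
        vector [\<X> * \<O>, \<X> * \<langle>P\<rangle> * dy],
        vector [dy * \<langle>P\<rangle> * dy_inv * \<O>, dy * (1 + \<langle>P\<rangle> * dy_inv * \<langle>P\<rangle> * dy)]]"
    (is "converted _ _ _ _ ?K = ?R")
proof -
  \<comment> \<open>\<open>K_\<omega>_deriv\<close> collapses the part of each adjoint column along
    \<open>a\<close>; the summand \<open>-(0, 1)\<close> of the second column adds the term in
    \<open>\<gamma>\<close>.\<close>
  have K1: "?K $ 1 $ 1 * madj T $ 1 $ k + ?K $ 1 $ 2 * madj T $ 2 $ k
      = (if k = 1 then - (\<langle>\<omega>\<rangle> * \<langle>\<omega>\<rangle> * \<O>) else - (\<langle>\<omega>\<rangle> * \<langle>\<omega>\<rangle> * \<langle>P\<rangle> * dy) - \<langle>\<gamma>\<rangle> * dx)" for k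
  proof -
    have "?K $ 1 $ 1 * (\<langle>\<omega>_deriv 1\<rangle> * (dy_inv * p)) + ?K $ 1 $ 2 * (\<langle>\<omega>_deriv 2\<rangle> * (dy_inv * p))
        = \<langle>\<omega>\<rangle> * (\<langle>\<omega>\<rangle> * p)" for p
    proof -
      have "?K $ 1 $ 1 * (\<langle>\<omega>_deriv 1\<rangle> * (dy_inv * p)) + ?K $ 1 $ 2 * (\<langle>\<omega>_deriv 2\<rangle> * (dy_inv * p))
          = \<langle>\<omega>\<rangle> * \<langle>\<omega>\<rangle> * dy * (dy_inv * p)"
        unfolding K_\<omega>_deriv(1)[symmetric] by (simp only: vector_2 distrib_right mult.assoc)
      then show ?thesis by (simp only: mult.assoc dy_cancel)
    qed
    \<comment> \<open>Folding solves each identity for one summand, so that it serves as a rewrite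
      rule.\<close>
    from this[of \<O>, folded eq_diff_eq] this[of "\<langle>P\<rangle> * dy", folded eq_diff_eq] show ?thesis
      using exhaust_2[of k]
      by (elim disjE) (simp_all add: madj_T1 madj_T2 mult.assoc right_diff_distrib)
  qed
  have K2: "?K $ 2 $ 1 * madj T $ 1 $ k + ?K $ 2 $ 2 * madj T $ 2 $ k
      = (if k = 1 then 0 else - (2 * dx))" for k
  proof -
    have "?K $ 2 $ 1 * (\<langle>\<omega>_deriv 1\<rangle> * p) + ?K $ 2 $ 2 * (\<langle>\<omega>_deriv 2\<rangle> * p) = 0" for p
    proof -
      have "?K $ 2 $ 1 * (\<langle>\<omega>_deriv 1\<rangle> * p) + ?K $ 2 $ 2 * (\<langle>\<omega>_deriv 2\<rangle> * p)
          = (dx * \<langle>\<gamma>\<rangle> * \<langle>\<omega>_deriv 1\<rangle> + 2 * dx * \<langle>\<omega>_deriv 2\<rangle>) * p"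
        by (simp only: vector_2 distrib_right mult.assoc)
      then show ?thesis by (simp only: K_\<omega>_deriv(2) mult_zero_left)
    qed
    from this[of "dy_inv * \<O>", folded eq_neg_iff_add_eq_0]
      this[of "dy_inv * (\<langle>P\<rangle> * dy)", folded eq_neg_iff_add_eq_0] show ?thesis
      using exhaust_2[of k]
      by (elim disjE) (simp_all add: madj_T1 madj_T2 mult.assoc right_diff_distrib)
  qed
  \<comment> \<open>By this identity the off-diagonal entry in \<open>K1\<close> is zero. Hence the
    product of \<open>?K\<close> with \<open>madj T\<close> is diagonal, with entries
    \<open>-(\<langle>\<omega>\<rangle> * \<langle>\<omega>\<rangle> * \<O>)\<close> and
    \<open>-(2 * dx)\<close>, and each entry of the result comes from one scaled entry of
    \<open>T\<close>.\<close>
  have \<gamma>: "\<langle>\<gamma>\<rangle> * dx = - (\<langle>\<omega>\<rangle> * \<langle>\<omega>\<rangle> * \<langle>P\<rangle> * dy)"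
  proof -
    have "\<omega> * \<omega> * P * \<omega>' = - \<gamma>"
      using \<omega>_inv by (simp add: P_def mult.assoc mult.left_commute)
    then have "\<langle>\<omega>\<rangle> * \<langle>\<omega>\<rangle> * \<langle>P\<rangle> * \<langle>\<omega>'\<rangle> = - \<langle>\<gamma>\<rangle>"
      by (simp add: mop_mult mop_uminus)
    then show ?thesis
      by (simp add: dy_def mult.assoc[symmetric])
  qed
  have "converted pd \<omega> \<omega>' (vector [Q, P]) ?K $ i $ k = ?R $ i $ k" for i k
  proof -
    have P: "\<langle>\<omega>'\<rangle> * (\<langle>P\<rangle> * r) = \<langle>P\<rangle> * (\<langle>\<omega>'\<rangle> * r)" for r
      by (rule mop_left_commute)
    show ?thesis
      unfolding converted_nth K1 K2 unfolding \<gamma>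
      using exhaust_2[of i] exhaust_2[of k]
      by (elim disjE; simp add: mat_matrix_mult_nth vector_2 scaled_T1 scaled_T2 mop_\<omega>_deriv;
        simp add: distrib_left distrib_right left_diff_distrib right_diff_distrib mult.assoc
          mult_2 P mop_inverse' dx_eq;
        simp only: add_ac)
  qed
  then show ?thesis
    by (simp add: vec_eq_iff)
qed

end

theorem theorem4p1:
  fixes u :: "2 \<Rightarrow> 'a::differential_algebra"
    and pd :: "2 \<Rightarrow> nat \<Rightarrow> 'a \<Rightarrow> 'a"
    and \<rho> \<gamma> \<omega> \<omega>' Q P Qy Py :: 'a
    and dy dy_inv \<O> \<X> \<Y> :: "'a pdo"
    and \<K> \<J> \<K>' \<J>' :: "'a pdo ^ 2 ^ 2"
  assumes "differential_functions u pd"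
    and "\<rho> = u 1" and "\<gamma> = u 2"
    and "\<omega>\<^sup>2 = 4 * \<rho> - \<gamma>\<^sup>2" and "\<omega> * \<omega>' = 1"
    and "Q = \<omega>' * (1 - Dx \<omega> * \<omega>')" and "P = - \<gamma> * \<omega>'"
    and "\<K> = vector [vector [\<langle>\<rho>\<rangle> * dx + dx * \<langle>\<rho>\<rangle>, \<langle>\<gamma>\<rangle> * dx],
                     vector [dx * \<langle>\<gamma>\<rangle>, 2 * dx]]"
    and "\<J> = vector [vector [0, dx - dx\<^sup>2],
                     vector [dx + dx\<^sup>2, 0]]"
    and "dy = \<langle>\<omega>'\<rangle> * dx" and "dy * dy_inv = 1" and "dy_inv * dy = 1"
    and "Qy = \<omega>' * Dx Q" and "Py = \<omega>' * Dx P"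
    and "\<O> = \<langle>Q\<rangle> * dy - dy\<^sup>2"
    and "\<X> = dy + \<langle>Q\<rangle> + \<langle>Qy\<rangle> * dy_inv"
    and "\<Y> = 1 + \<langle>P\<rangle>\<^sup>2 + \<langle>Py\<rangle> * dy_inv * \<langle>P\<rangle>"
    and "\<K>' = mat 2 ** vector [
        vector [\<X> * (\<langle>P\<rangle> * \<X> + \<O> * \<langle>P\<rangle> * dy_inv) * \<O>,
                \<X> * (\<langle>P\<rangle> * \<X> * \<langle>P\<rangle> * dy + \<O> * (1 + \<langle>P\<rangle> * dy_inv * \<langle>P\<rangle> * dy))],
        vector [\<Y> * \<X> * \<O> + (\<langle>Py\<rangle> * dy_inv + \<langle>P\<rangle>) * \<O> * \<langle>P\<rangle> * dy_inv * \<O>,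
                \<Y> * \<X> * \<langle>P\<rangle> * dy
                  + (\<langle>Py\<rangle> * dy_inv + \<langle>P\<rangle>) * \<O> * (1 + \<langle>P\<rangle> * dy_inv * \<langle>P\<rangle> * dy)]]"
    and "\<J>' = mat 2 ** vector [
        vector [\<X> * \<O>, \<X> * \<langle>P\<rangle> * dy],
        vector [dy * \<langle>P\<rangle> * dy_inv * \<O>, dy * (1 + \<langle>P\<rangle> * dy_inv * \<langle>P\<rangle> * dy)]]"
  shows "converted pd \<omega> \<omega>' (vector [Q, P]) \<J> = \<K>'
       \<and> converted pd \<omega> \<omega>' (vector [Q, P]) \<K> = \<J>'"
proof -
  interpret dispersive_coordinates u pd \<rho> \<gamma> \<omega> \<omega>' Q P Qy Py dy dy_inv \<O> \<X> \<Y>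
    using assms by (simp only: dispersive_coordinates_def dispersive_coordinates_axioms_def)
  show ?thesis
    unfolding assms(8,9,18,19) using converted_J converted_K by blast
qed

end
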